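(* Let $(X,\omega)$ be a translation surface whose Veech group $V$ is commensurable to the Hecke triangle group $G_{18}$. Then there are infinitely many distinct $V$-orbits of directions that are invariant under a special affine pseudo-Anosov homeomorphism of $(X,\omega)$.
   Context: $G_{18}\subset \mathrm{SL}(2,\mathbb{R})$ is generated by $S = \begin{pmatrix} 0 & -1 \\ 1 & 0 \end{pmatrix}$ and $T_{18} = \begin{pmatrix} 1 & \lambda_{18} \\ 0 & 1 \end{pmatrix}$ with $\lambda_{18} = 2\cos(\pi/18)$. The Veech group $V$ of a translation surface $(X,\omega)$ is the group of derivatives (in $\mathrm{SL}(2,\mathbb{R})$) of orientation-preserving affine automorphisms of $(X,\omega)$; it acts on directions (points of $\mathbb{P}^1(\mathbb{R})$). Two subgroups of $\mathrm{SL}(2,\mathbb{R})$ are commensurable if (up to conjugation in $\mathrm{SL}(2,\mathbb{R})$) their intersection has finite index in each. The invariant trace field of $V$ is $\mathbb{Q}(\mathrm{Tr}(A^2): A\in V)$. An affine pseudo-Anosov homeomorphism of $(X,\omega)$ is an affine automorphism whose derivative is hyperbolic ($|\mathrm{Tr}|>2$); it is special if its derivative has eigenvalues in the invariant trace field of $V$. A direction is invariant under it if it is an eigendirection of its derivative. *)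

theory Defs
  imports "HOL-Analysis.Analysis"
begin

type_synonym mat2 = "real^2^2"

definition mk2 :: "real \<Rightarrow> real \<Rightarrow> real \<Rightarrow> real \<Rightarrow> mat2" where
  "mk2 a b c d = (\<chi> i j. if i = 1 then (if j = 1 then a else b) else (if j = 1 then c else d))"

definition SL2 :: "mat2 set" where
  "SL2 = {A. det A = 1}"

definition is_subgroup_SL2 :: "mat2 set \<Rightarrow> bool" where
  "is_subgroup_SL2 H \<longleftrightarrow> H \<subseteq> SL2 \<and> mat 1 \<in> H \<and>
     (\<forall>A\<in>H. \<forall>B\<in>H. A ** B \<in> H) \<and> (\<forall>A\<in>H. matrix_inv A \<in> H)"

definition gen_subgroup :: "mat2 set \<Rightarrow> mat2 set" where
  "gen_subgroup X = \<Inter>{H. is_subgroup_SL2 H \<and> X \<subseteq> H}"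

definition lambda18 :: real where "lambda18 = 2 * cos (pi / 18)"

definition S_mat :: mat2 where "S_mat = mk2 0 (-1) 1 0"
definition T18 :: mat2 where "T18 = mk2 1 lambda18 0 1"

definition G18 :: "mat2 set" where "G18 = gen_subgroup {S_mat, T18}"

definition finite_index :: "mat2 set \<Rightarrow> mat2 set \<Rightarrow> bool" where
  "finite_index H G \<longleftrightarrow> finite {(\<lambda>x. g ** x) ` H | g. g \<in> G}"

definition commensurable :: "mat2 set \<Rightarrow> mat2 set \<Rightarrow> bool" where
  "commensurable V W \<longleftrightarrow> (\<exists>g\<in>SL2.
     (let V' = (\<lambda>A. g ** A ** matrix_inv g) ` V in
       finite_index (V' \<inter> W) V' \<and> finite_index (V' \<inter> W) W))"

definition is_subfield_R :: "real set \<Rightarrow> bool" where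
  "is_subfield_R F \<longleftrightarrow> 0 \<in> F \<and> 1 \<in> F \<and> (\<forall>x\<in>F. \<forall>y\<in>F. x + y \<in> F \<and> x * y \<in> F) \<and>
     (\<forall>x\<in>F. - x \<in> F \<and> inverse x \<in> F)"

definition invariant_trace_field :: "mat2 set \<Rightarrow> real set" where
  "invariant_trace_field V =
     \<Inter>{F. is_subfield_R F \<and> {trace (A ** A) | A. A \<in> V} \<subseteq> F}"

definition hyperbolic :: "mat2 \<Rightarrow> bool" where
  "hyperbolic A \<longleftrightarrow> \<bar>trace A\<bar> > 2"

definition eigenvalue :: "mat2 \<Rightarrow> real \<Rightarrow> bool" where
  "eigenvalue A c \<longleftrightarrow> (\<exists>v. v \<noteq> 0 \<and> A *v v = c *\<^sub>R v)"

text \<open>Special: derivative hyperbolic with eigenvalues in the invariant trace field of V.\<close>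
definition special_hyperbolic :: "mat2 set \<Rightarrow> mat2 \<Rightarrow> bool" where
  "special_hyperbolic V A \<longleftrightarrow> hyperbolic A \<and>
     (\<forall>c. eigenvalue A c \<longrightarrow> c \<in> invariant_trace_field V)"

definition directions :: "(real^2) set set" where
  "directions = {span {v} | v. v \<noteq> (0::real^2)}"

definition eigendirection :: "mat2 \<Rightarrow> (real^2) set \<Rightarrow> bool" where
  "eigendirection A L \<longleftrightarrow> (\<exists>v c. v \<noteq> 0 \<and> L = span {v} \<and> A *v v = c *\<^sub>R v)"

definition dir_orbit :: "mat2 set \<Rightarrow> (real^2) set \<Rightarrow> (real^2) set set" where
  "dir_orbit V L = {(\<lambda>x. A *v x) ` L | A. A \<in> V}"

end

(*
  Let l = lambda18, t = l^2, so t^3 = 6 t^2 - 9 t + 3, and put U = (1 l; 0 1), L = (1 0; l 1).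
  The number 4 t^2 + 1 is the square of 1 - 6 t + 2 t^2, hence B = U^8 (L^-1 U^-2 L), of trace
  2 + 16 t^2, has its eigenvalue xi in Z[t]. With P = L U L^-1 and C = (L^-1 U^-2 L) U^8, the element
  W_n = B^n P C^n has the same trace as B^(2n), so it is special as well.

  The eigendirections of W_n, for n a power of 2, lie in distinct orbits: if g in G18 carries that
  of W_n to that of W_m, where n = 2 s m, then discreteness forces g W_n g^-1 = W_m^(2 s), and by
  Cayley-Hamilton W_n = tr(Z) g^-1 Z g - 1 with Z = W_m^s. Now tr(Z) is divisible by 2 in Z[t],
  while W_n is congruent to P modulo 2 and the lower left entry -l t of P is not divisible by 2.

  Discreteness holds because, up to sign and factors S on both sides, every element of G18 is a
  product of the matrices (TS)^k S, 1 <= k <= 17, whose entries are 0 or at least 1.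
*)
theory Submission
  imports Defs
begin

section \<open>Two-by-two matrices and discreteness of the Hecke group\<close>

text \<open>The powers of \<open>B18\<close> all have the same eigendirections, so a construction is
  needed that moves the direction while keeping the trace under control: the unipotent factor
  \<open>P18\<close> is put between powers of two conjugate matrices. The price is that eigenvalues
  do not separate the resulting directions, since all of them are powers of \<open>\<xi>\<close>; a
  residue modulo 2 has to do it. This is why the unipotent exponents 8 and -2 in \<open>B18\<close>
  and \<open>C18\<close> are even, so that only \<open>P18\<close> is left modulo 2. It is also why
  n runs through powers of 2: the quotient of two such exponents is even.

  Inequivalence is proved under the whole of \<open>G18\<close>, and commensurability then costs
  only finite factors. The index in \<open>G18\<close> is used to bring a power of each
  \<open>W18 n\<close> into the conjugated Veech group; the index in that group limits how many
  \<open>G18\<close>-inequivalent directions a single \<open>V\<close>-orbit can contain.\<close>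

lemma mk2_nth [simp]:
  "mk2 a b c d $ 1 $ 1 = a" "mk2 a b c d $ 1 $ 2 = b"
  "mk2 a b c d $ 2 $ 1 = c" "mk2 a b c d $ 2 $ 2 = d"
  by (simp_all add: mk2_def)

lemma mk2_eta: "A = mk2 (A $ 1 $ 1) (A $ 1 $ 2) (A $ 2 $ 1) (A $ 2 $ 2)"
  by (simp add: vec_eq_iff forall_2)

lemma mk2_cases: obtains a b c d where "A = mk2 a b c d"
  using mk2_eta by blast

lemma mk2_eq_iff [simp]:
  "mk2 a b c d = mk2 a' b' c' d' \<longleftrightarrow> a = a' \<and> b = b' \<and> c = c' \<and> d = d'"
  by (metis mk2_nth)

lemma mk2_mult [simp]:
  "mk2 a b c d ** mk2 a' b' c' d' =
     mk2 (a * a' + b * c') (a * b' + b * d') (c * a' + d * c') (c * b' + d * d')"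
  by (simp add: vec_eq_iff forall_2 matrix_matrix_mult_def sum_2)

lemma mk2_mult_vec_nth [simp]:
  "(mk2 a b c d *v v) $ 1 = a * v $ 1 + b * v $ 2"
  "(mk2 a b c d *v v) $ 2 = c * v $ 1 + d * v $ 2"
  by (simp_all add: matrix_vector_mult_def sum_2)

lemma det_mk2 [simp]: "det (mk2 a b c d) = a * d - b * c"
  by (simp add: det_2)

lemma trace_mk2 [simp]: "trace (mk2 a b c d) = a + d"
  by (simp add: trace_def sum_2)

lemma mat_1_mk2: "(mat 1 :: mat2) = mk2 1 0 0 1"
  by (simp add: vec_eq_iff forall_2 mat_def)

lemma scaleR_mk2 [simp]: "r *\<^sub>R mk2 a b c d = mk2 (r * a) (r * b) (r * c) (r * d)"
  by (simp add: vec_eq_iff forall_2)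

lemma add_mk2 [simp]: "mk2 a b c d + mk2 a' b' c' d' = mk2 (a + a') (b + b') (c + c') (d + d')"
  by (simp add: vec_eq_iff forall_2)

lemma diff_mk2 [simp]: "mk2 a b c d - mk2 a' b' c' d' = mk2 (a - a') (b - b') (c - c') (d - d')"
  by (simp add: vec_eq_iff forall_2)

lemma minus_mk2 [simp]: "- mk2 a b c d = mk2 (- a) (- b) (- c) (- d)"
  by (simp add: vec_eq_iff forall_2)

lemma matrix_inv_eqI:
  fixes A B :: mat2
  assumes "A ** B = mat 1" "B ** A = mat 1" shows "matrix_inv A = B"
proof -
  have "A ** matrix_inv A = mat 1"
    unfolding matrix_inv_def by (rule someI2[of _ B]) (use assms in auto)
  then have "B ** (A ** matrix_inv A) = B" by simp
  then show ?thesis by (simp add: matrix_mul_assoc assms)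
qed

lemma matrix_inv_mk2:
  assumes "a * d - b * c = 1"
  shows "matrix_inv (mk2 a b c d) = mk2 d (- b) (- c) a"
proof (rule matrix_inv_eqI)
  show "mk2 a b c d ** mk2 d (- b) (- c) a = mat 1"
    using assms by (simp add: mat_1_mk2 algebra_simps)
  show "mk2 d (- b) (- c) a ** mk2 a b c d = mat 1"
    using assms by (simp add: mat_1_mk2 algebra_simps)
qed

lemma SL2_mult: "A \<in> SL2 \<Longrightarrow> B \<in> SL2 \<Longrightarrow> A ** B \<in> SL2"
  by (simp add: SL2_def det_mul)

lemma SL2_inv:
  assumes "A \<in> SL2"
  shows "matrix_inv A ** A = mat 1" "A ** matrix_inv A = mat 1" "matrix_inv A \<in> SL2"
proof -
  obtain a b c d where A: "A = mk2 a b c d" by (rule mk2_cases)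
  have D: "a * d - b * c = 1" using assms by (simp add: SL2_def A)
  show "matrix_inv A ** A = mat 1" "A ** matrix_inv A = mat 1" "matrix_inv A \<in> SL2"
    using D unfolding A matrix_inv_mk2[OF D] by (simp_all add: mat_1_mk2 SL2_def algebra_simps)
qed

lemma SL2_1: "mat 1 \<in> SL2"
  by (simp add: SL2_def mat_1_mk2)

lemma SL2_inv_inv: "A \<in> SL2 \<Longrightarrow> matrix_inv (matrix_inv A) = A"
  by (rule matrix_inv_eqI) (simp_all add: SL2_inv)

lemma SL2_left_cancel: "A \<in> SL2 \<Longrightarrow> A ** X = A ** Y \<longleftrightarrow> X = Y"
  by (metis SL2_inv(1) matrix_mul_assoc matrix_mul_lid)

lemma matrix_scaleR_mult_left: "(r *\<^sub>R A) ** (B :: mat2) = r *\<^sub>R (A ** B)"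
  by (simp add: vec_eq_iff matrix_matrix_mult_def sum_distrib_left mult.assoc)

lemma matrix_scaleR_mult_right: "(A :: mat2) ** (r *\<^sub>R B) = r *\<^sub>R (A ** B)"
  by (simp add: vec_eq_iff matrix_matrix_mult_def sum_distrib_left mult.left_commute)

lemma is_subgroup_SL2_SL2: "is_subgroup_SL2 SL2"
  by (simp add: is_subgroup_SL2_def SL2_1 SL2_mult SL2_inv)

lemma is_subgroup_SL2_Inter:
  assumes "\<And>H. H \<in> \<H> \<Longrightarrow> is_subgroup_SL2 H" "\<H> \<noteq> {}"
  shows "is_subgroup_SL2 (\<Inter>\<H>)"
  using assms unfolding is_subgroup_SL2_def by blast

lemma S_mat_SL2: "S_mat \<in> SL2" and T18_SL2: "T18 \<in> SL2"
  by (simp_all add: SL2_def S_mat_def T18_def)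

lemma is_subgroup_G18: "is_subgroup_SL2 G18"
  unfolding G18_def gen_subgroup_def
proof (rule is_subgroup_SL2_Inter)
  show "{H. is_subgroup_SL2 H \<and> {S_mat, T18} \<subseteq> H} \<noteq> {}"
    using is_subgroup_SL2_SL2 S_mat_SL2 T18_SL2 by blast
qed blast

lemma S_mat_G18: "S_mat \<in> G18" and T18_G18: "T18 \<in> G18"
  by (auto simp: G18_def gen_subgroup_def)

lemma G18_subset: "is_subgroup_SL2 H \<Longrightarrow> S_mat \<in> H \<Longrightarrow> T18 \<in> H \<Longrightarrow> G18 \<subseteq> H"
  by (auto simp: G18_def gen_subgroup_def)

lemma G18_SL2: "A \<in> G18 \<Longrightarrow> A \<in> SL2"
  and G18_mult: "A \<in> G18 \<Longrightarrow> B \<in> G18 \<Longrightarrow> A ** B \<in> G18"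
  and G18_inv: "A \<in> G18 \<Longrightarrow> matrix_inv A \<in> G18"
  and G18_1: "mat 1 \<in> G18"
  using is_subgroup_G18 by (auto simp: is_subgroup_SL2_def)

section \<open>Sine ratios and the powers of the elliptic element TS\<close>

text \<open>These are the values of the Chebyshev polynomials of the second kind at cos(pi/18), with
  the index shifted by one. Their recurrence has multiplier \<open>lambda18\<close>, the trace of
  TS, so they are up to sign the entries of the powers of TS.\<close>

definition sin_ratio :: "nat \<Rightarrow> real" where
  "sin_ratio k = sin (k * (pi / 18)) / sin (pi / 18)"

lemma sin_pi_18_pos: "sin (pi / 18) > 0"
  by (rule sin_gt_zero) (use pi_gt_zero in auto)

lemma sin_ratio_simps [simp]: "sin_ratio 0 = 0" "sin_ratio (Suc 0) = 1" "sin_ratio 18 = 0"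
  using sin_pi_18_pos by (simp_all add: sin_ratio_def)

lemma sin_ratio_19: "sin_ratio 19 = -1"
proof -
  have "sin (19 * (pi / 18)) = sin (pi / 18 + pi)" by (simp add: field_simps)
  also have "\<dots> = - sin (pi / 18)" by (rule sin_periodic_pi)
  finally show ?thesis using sin_pi_18_pos by (simp add: sin_ratio_def)
qed

lemma sin_ratio_reflect: 
  assumes "k \<le> 18" shows "sin_ratio (18 - k) = sin_ratio k"
proof -
  have "sin (real (18 - k) * (pi / 18)) = sin (pi - k * (pi / 18))"
    using assms by (simp add: of_nat_diff field_simps)
  then show ?thesis by (simp add: sin_ratio_def)
qed

lemma sin_ratio_rec: "sin_ratio (Suc (Suc k)) = lambda18 * sin_ratio (Suc k) - sin_ratio k"
proof -
  define \<theta> where "\<theta> = pi / 18"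
  have "sin (Suc (Suc k) * \<theta>) = sin (Suc k * \<theta> + \<theta>)" by (simp add: algebra_simps)
  moreover have "sin (k * \<theta>) = sin (Suc k * \<theta> - \<theta>)" by (simp add: algebra_simps)
  ultimately have "sin (Suc (Suc k) * \<theta>) = 2 * cos \<theta> * sin (Suc k * \<theta>) - sin (k * \<theta>)"
    unfolding sin_add sin_diff by simp
  then show ?thesis
    by (simp add: sin_ratio_def lambda18_def \<theta>_def diff_divide_distrib)
qed

text \<open>Sine increases up to the right angle, which is reached at k = 9; the reflection of k to
  18 - k covers the other half.\<close>

lemma sin_ratio_ge_1:
  assumes "1 \<le> k" "k \<le> 17" shows "sin_ratio k \<ge> 1"
proof -
  have main: "sin_ratio k \<ge> 1" if "1 \<le> k" "k \<le> 9" for k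
  proof -
    have "real k * (pi / 18) \<le> 9 * (pi / 18)"
      using that by (intro mult_right_mono) auto
    moreover have "1 * (pi / 18) \<le> real k * (pi / 18)"
      using that by (intro mult_right_mono) auto
    ultimately have "sin (pi / 18) \<le> sin (k * (pi / 18))"
      by (intro sin_monotone_2pi_le) auto
    then show ?thesis using sin_pi_18_pos by (simp add: sin_ratio_def)
  qed
  show ?thesis
  proof (cases "k \<le> 9")
    case False
    then have "sin_ratio (18 - k) \<ge> 1" using assms by (intro main) auto
    then show ?thesis using sin_ratio_reflect[of k] assms by simp
  qed (use main assms in auto)
qed

text \<open>For k at least 1 this is (TS)^(k-1) T, which equals -(TS)^k S. The sign is chosen so
  that all entries are nonnegative for k from 1 to 17.\<close>

definition hecke_step :: "nat \<Rightarrow> mat2" where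
  "hecke_step k = mk2 (sin_ratio k) (sin_ratio (k + 1)) (sin_ratio (k - 1)) (sin_ratio k)"

lemma lambda18_sin_ratio: "sin_ratio 2 = lambda18"
  by (simp add: numeral_2_eq_2 sin_ratio_rec)

lemma hecke_step_1: "hecke_step 1 = T18"
  using lambda18_sin_ratio by (simp add: hecke_step_def T18_def numeral_2_eq_2)

lemma hecke_step_17: "hecke_step 17 = mk2 1 0 lambda18 1"
  using sin_ratio_reflect[of 1] sin_ratio_reflect[of 2]
  by (simp add: hecke_step_def lambda18_sin_ratio)

lemma hecke_step_18: "hecke_step 18 = S_mat"
  using sin_ratio_reflect[of 1] sin_ratio_19
  by (simp add: hecke_step_def S_mat_def)

lemma hecke_step_Suc:
  assumes "1 \<le> k" shows "T18 ** S_mat ** hecke_step k = hecke_step (Suc k)"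
proof -
  obtain j where "k = Suc j" using assms by (cases k) auto
  then show ?thesis
    using sin_ratio_rec[of j] sin_ratio_rec[of "Suc j"]
    by (simp add: hecke_step_def T18_def S_mat_def)
qed

section \<open>Normal forms for the Hecke group and the gap in its matrix entries\<close>

inductive_set hecke_monoid :: "mat2 set" where
  one: "mat 1 \<in> hecke_monoid"
| step: "m \<in> hecke_monoid \<Longrightarrow> 1 \<le> k \<Longrightarrow> k \<le> 17 \<Longrightarrow> hecke_step k ** m \<in> hecke_monoid"

text \<open>This set is closed under sums and products, so matrices with entries in it form a
  monoid. Discreteness thereby reduces to the entries of the generators of
  \<open>hecke_monoid\<close>.\<close>

definition gap_reals :: "real set" where "gap_reals = {0} \<union> {1..}"

lemma gap_reals_add_mult:
  assumes "a \<in> gap_reals" "b \<in> gap_reals"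
  shows "a + b \<in> gap_reals" "a * b \<in> gap_reals"
  using assms mult_mono[of 1 a 1 b] by (auto simp: gap_reals_def)

lemma sin_ratio_gap: "k \<le> 18 \<Longrightarrow> sin_ratio k \<in> gap_reals"
  using sin_ratio_ge_1[of k] by (cases "k = 0 \<or> k = 18") (auto simp: gap_reals_def)

lemma hecke_monoid_gap:
  assumes "m \<in> hecke_monoid" shows "m $ i $ j \<in> gap_reals"
proof -
  have "\<forall>i j. m $ i $ j \<in> gap_reals" using assms
  proof induction
    case one
    then show ?case by (simp add: mat_1_mk2 forall_2 gap_reals_def)
  next
    case (step m k)
    obtain a b c d where m: "m = mk2 a b c d" by (rule mk2_cases)
    show ?case
      using step sin_ratio_gap[of k] sin_ratio_gap[of "k + 1"] sin_ratio_gap[of "k - 1"]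
      by (simp add: m hecke_step_def forall_2 gap_reals_add_mult)
  qed
  then show ?thesis by blast
qed

text \<open>At most one S is required at each end, because two adjacent factors S give the sign
  -1.\<close>

definition hecke_words :: "mat2 set" where
  "hecke_words = {s *\<^sub>R (X ** m ** Y) | s X m Y.
     s \<in> {1, -1} \<and> X \<in> {mat 1, S_mat} \<and> m \<in> hecke_monoid \<and> Y \<in> {mat 1, S_mat}}"

lemma hecke_wordsI:
  "s \<in> {1, -1} \<Longrightarrow> X \<in> {mat 1, S_mat} \<Longrightarrow> m \<in> hecke_monoid \<Longrightarrow> Y \<in> {mat 1, S_mat} \<Longrightarrow>
   s *\<^sub>R (X ** m ** Y) \<in> hecke_words"
  unfolding hecke_words_def by blast

lemma S_mat_square: "S_mat ** S_mat = - 1 *\<^sub>R mat 1"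
  by (simp add: S_mat_def mat_1_mk2)

lemma hecke_words_uminus: "A \<in> hecke_words \<Longrightarrow> - A \<in> hecke_words"
proof -
  assume "A \<in> hecke_words"
  then obtain s X m Y where A: "A = s *\<^sub>R (X ** m ** Y)" and s: "s \<in> {1, -1}"
    and X: "X \<in> {mat 1, S_mat}" and mY: "m \<in> hecke_monoid" "Y \<in> {mat 1, S_mat}"
    unfolding hecke_words_def by blast
  have "(- s) *\<^sub>R (X ** m ** Y) \<in> hecke_words"
    using s X mY by (intro hecke_wordsI) auto
  then show ?thesis by (simp add: A)
qed

lemma hecke_words_S: 
  assumes "A \<in> hecke_words" shows "S_mat ** A \<in> hecke_words"
proof -
  obtain s X m Y where A: "A = s *\<^sub>R (X ** m ** Y)" and s: "s \<in> {1, -1}"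
    and X: "X \<in> {mat 1, S_mat}" and mY: "m \<in> hecke_monoid" "Y \<in> {mat 1, S_mat}"
    using assms unfolding hecke_words_def by blast
  show ?thesis
  proof (cases "X = mat 1")
    case True
    have "S_mat ** A = s *\<^sub>R (S_mat ** m ** Y)"
      by (simp add: A True matrix_scaleR_mult_right matrix_mul_assoc)
    then show ?thesis using s mY by (auto intro!: hecke_wordsI)
  next
    case False
    then have "S_mat ** A = s *\<^sub>R ((S_mat ** S_mat) ** m ** Y)"
      using X by (simp add: A matrix_scaleR_mult_right matrix_mul_assoc)
    also have "\<dots> = (- s) *\<^sub>R (mat 1 ** m ** Y)"
      unfolding S_mat_square matrix_scaleR_mult_left by simp
    also have "\<dots> \<in> hecke_words" using s mY by (intro hecke_wordsI) auto
    finally show ?thesis .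
  qed
qed

lemma hecke_words_monoid:
  assumes "m \<in> hecke_monoid" "Y \<in> {mat 1, S_mat}"
  shows "m ** Y \<in> hecke_words" "m ** S_mat ** Y \<in> hecke_words"
proof -
  have A: "m ** Y' \<in> hecke_words" if "Y' \<in> {mat 1, S_mat}" for Y'
    using hecke_wordsI[of 1 "mat 1" m Y'] assms(1) that by simp
  then show "m ** Y \<in> hecke_words" using assms(2) by blast
  have "m ** S_mat ** S_mat = m ** (- 1 *\<^sub>R mat 1)"
    unfolding S_mat_square[symmetric] by (simp add: matrix_mul_assoc)
  then have "m ** S_mat ** S_mat = - m"
    unfolding matrix_scaleR_mult_right by simp
  then show "m ** S_mat ** Y \<in> hecke_words"
    using assms(2) A[of S_mat] A[of "mat 1"] hecke_words_uminus[of m] by auto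
qed

lemma hecke_words_scale: "s \<in> {1, -1} \<Longrightarrow> A \<in> hecke_words \<Longrightarrow> s *\<^sub>R A \<in> hecke_words"
  using hecke_words_uminus by auto

text \<open>T is itself \<open>hecke_step 1\<close>, so it is absorbed directly when no S precedes
  the monoid part. Otherwise TS raises the index of the leading step by one; if there is no leading
  step, the S moves to the right end.\<close>

lemma hecke_words_T:
  assumes "A \<in> hecke_words" shows "T18 ** A \<in> hecke_words"
proof -
  obtain s X m Y where A: "A = s *\<^sub>R (X ** m ** Y)" and s: "s \<in> {1, -1}"
    and X: "X \<in> {mat 1, S_mat}" and m: "m \<in> hecke_monoid" and Y: "Y \<in> {mat 1, S_mat}"
    using assms unfolding hecke_words_def by blast
  have T: "T18 ** m' \<in> hecke_monoid" if "m' \<in> hecke_monoid" for m'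
    using hecke_monoid.step[OF that, of 1] by (simp flip: hecke_step_1)
  have "T18 ** X ** m ** Y \<in> hecke_words"
  proof (cases "X = mat 1")
    case True
    then show ?thesis using hecke_words_monoid(1)[OF T[OF m] Y] by simp
  next
    case False
    then have X: "X = S_mat" using X by auto
    show ?thesis using m
    proof cases
      case one
      then show ?thesis
        using hecke_words_monoid(2)[OF T[OF hecke_monoid.one] Y] by (simp add: X)
    next
      case (step m' k)
      have eq: "T18 ** X ** m = hecke_step (Suc k) ** m'"
        using step(3) by (simp add: X step(1) matrix_mul_assoc hecke_step_Suc)
      show ?thesis
      \<comment> \<open>Raising the index 17 leaves the monoid: since (TS)^18 = -1, the step of
        index 18 degenerates to S, which is absorbed at the left end.\<close>
      proof (cases "k = 17")
        case True
        then show ?thesis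
          using hecke_words_S[OF hecke_words_monoid(1)[OF step(2) Y]]
          by (simp add: eq hecke_step_18 matrix_mul_assoc)
      next
        case False
        then have "hecke_step (Suc k) ** m' \<in> hecke_monoid"
          using step(2-4) by (intro hecke_monoid.step) auto
        then show ?thesis unfolding eq by (rule hecke_words_monoid(1)[OF _ Y])
      qed
    qed
  qed
  then show ?thesis
    using hecke_words_scale[OF s] by (simp add: A matrix_scaleR_mult_right matrix_mul_assoc)
qed

lemma T18_inv_mk2: "matrix_inv T18 = mk2 1 (- lambda18) 0 1"
  by (simp add: T18_def matrix_inv_mk2)

text \<open>The recursion is run backwards: a leading step of index above 1 drops by one and
  releases an S, and a leading step of index 1 cancels. In the remaining cases the inverse of T is
  rewritten through \<open>hecke_step 17\<close>, the lower unipotent generator.\<close>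

lemma hecke_words_T_inv:
  assumes "A \<in> hecke_words" shows "matrix_inv T18 ** A \<in> hecke_words"
proof -
  obtain s X m Y where A: "A = s *\<^sub>R (X ** m ** Y)" and s: "s \<in> {1, -1}"
    and X: "X \<in> {mat 1, S_mat}" and m: "m \<in> hecke_monoid" and Y: "Y \<in> {mat 1, S_mat}"
    using assms unfolding hecke_words_def by blast
  have inv_S: "matrix_inv T18 ** S_mat = S_mat ** hecke_step 17"
    by (simp add: T18_inv_mk2 S_mat_def hecke_step_17)
  have inv_1: "matrix_inv T18 = - (S_mat ** hecke_step 17 ** S_mat)"
    by (simp add: T18_inv_mk2 S_mat_def hecke_step_17)
  have L: "hecke_step 17 ** m' \<in> hecke_monoid" if "m' \<in> hecke_monoid" for m'
    using hecke_monoid.step[OF that, of 17] by simp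
  have "matrix_inv T18 ** X ** m ** Y \<in> hecke_words"
  proof (cases "X = mat 1")
    case True
    show ?thesis using m
    proof cases
      case one
      have "S_mat ** (hecke_step 17 ** S_mat ** Y) \<in> hecke_words"
        using hecke_words_monoid(2)[OF L[OF hecke_monoid.one] Y]
        by (intro hecke_words_S) simp
      then have "- (S_mat ** (hecke_step 17 ** S_mat ** Y)) \<in> hecke_words"
        by (rule hecke_words_uminus)
      moreover have "- (S_mat ** (hecke_step 17 ** S_mat ** Y)) = matrix_inv T18 ** Y"
        unfolding inv_1 using matrix_scaleR_mult_left[of "- 1" "S_mat ** hecke_step 17 ** S_mat" Y]
        by (simp add: matrix_mul_assoc)
      ultimately show ?thesis by (simp add: True one)
    next
      case (step m' k)
      show ?thesis
      proof (cases "k = 1")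
        case True
        have "matrix_inv T18 ** m = m'"
          unfolding step(1) True hecke_step_1 matrix_mul_assoc SL2_inv(1)[OF T18_SL2] by simp
        then show ?thesis
          using hecke_words_monoid(1)[OF step(2) Y] by (simp add: \<open>X = mat 1\<close>)
      next
        case False
        then obtain j where j: "k = Suc j" "1 \<le> j" using step(3) by (cases k) auto
        have "matrix_inv T18 ** hecke_step k = matrix_inv T18 ** T18 ** (S_mat ** hecke_step j)"
          unfolding j(1) hecke_step_Suc[OF j(2), symmetric] by (simp add: matrix_mul_assoc)
        also have "\<dots> = S_mat ** hecke_step j"
          by (simp add: SL2_inv(1)[OF T18_SL2])
        finally have "matrix_inv T18 ** m ** Y = S_mat ** (hecke_step j ** m' ** Y)"
          by (simp add: step(1) matrix_mul_assoc)
        moreover have "hecke_step j ** m' \<in> hecke_monoid"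
          using step j by (intro hecke_monoid.step) auto
        ultimately show ?thesis
          using hecke_words_S[OF hecke_words_monoid(1)[OF _ Y]] by (simp add: True)
      qed
    qed
  next
    case False
    then have "matrix_inv T18 ** X ** m ** Y = S_mat ** (hecke_step 17 ** m ** Y)"
      using X by (simp add: inv_S matrix_mul_assoc)
    then show ?thesis
      using hecke_words_S[OF hecke_words_monoid(1)[OF L[OF m] Y]] by simp
  qed
  then show ?thesis
    using hecke_words_scale[OF s] by (simp add: A matrix_scaleR_mult_right matrix_mul_assoc)
qed

text \<open>Closure of \<open>hecke_words\<close> under products and inverses is not visible from
  its form. Its stabilizer under left multiplication is a group in any case, so only the generators
  have to be tested; the equivalence in the condition is what provides inverses.\<close>

lemma is_subgroup_SL2_stabilizer:
  "is_subgroup_SL2 {A \<in> SL2. \<forall>x. A ** x \<in> P \<longleftrightarrow> x \<in> P}"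
  unfolding is_subgroup_SL2_def
proof (intro conjI ballI)
  fix A assume A: "A \<in> {A \<in> SL2. \<forall>x. A ** x \<in> P \<longleftrightarrow> x \<in> P}"
  have "matrix_inv A ** x \<in> P \<longleftrightarrow> x \<in> P" for x
  proof -
    have "A ** (matrix_inv A ** x) = x"
      using A by (simp add: matrix_mul_assoc SL2_inv)
    then show ?thesis using A by (metis (mono_tags, lifting) mem_Collect_eq)
  qed
  then show "matrix_inv A \<in> {A \<in> SL2. \<forall>x. A ** x \<in> P \<longleftrightarrow> x \<in> P}"
    using A SL2_inv(3) by blast
qed (auto simp: SL2_1 SL2_mult simp flip: matrix_mul_assoc)

lemma G18_hecke_words: "G18 \<subseteq> hecke_words"
proof
  fix A assume A: "A \<in> G18"
  let ?H = "{A \<in> SL2. \<forall>x. A ** x \<in> hecke_words \<longleftrightarrow> x \<in> hecke_words}"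
  have "x \<in> hecke_words" if "S_mat ** x \<in> hecke_words" for x
  proof -
    have "S_mat ** (S_mat ** x) = (- 1 *\<^sub>R mat 1) ** x"
      unfolding S_mat_square[symmetric] by (simp add: matrix_mul_assoc)
    then have "S_mat ** (S_mat ** x) = - x"
      unfolding matrix_scaleR_mult_left by simp
    then show ?thesis
      using hecke_words_uminus[OF hecke_words_S[OF that]] by simp
  qed
  then have S: "S_mat \<in> ?H" using S_mat_SL2 hecke_words_S by blast
  have "x \<in> hecke_words" if "T18 ** x \<in> hecke_words" for x
    using hecke_words_T_inv[OF that] by (simp add: matrix_mul_assoc SL2_inv(1)[OF T18_SL2])
  then have T: "T18 \<in> ?H" using T18_SL2 hecke_words_T by blast
  have "A \<in> ?H"
    using G18_subset[OF is_subgroup_SL2_stabilizer S T] A by blast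
  moreover have "mat 1 \<in> hecke_words"
    using hecke_words_monoid(1)[OF hecke_monoid.one, of "mat 1"] by simp
  ultimately show "A \<in> hecke_words" by (metis (mono_tags, lifting) matrix_mul_rid mem_Collect_eq)
qed

text \<open>Multiplication by S on either side and by a sign only permutes the entries and changes
  their signs, so the gap of the monoid entries survives in absolute value.\<close>

lemma G18_entry_gap:
  assumes "A \<in> G18" "\<bar>A $ i $ j\<bar> < 1" shows "A $ i $ j = 0"
proof -
  obtain s X m Y where A: "A = s *\<^sub>R (X ** m ** Y)" and s: "s \<in> {1, -1}"
    and X: "X \<in> {mat 1, S_mat}" and m: "m \<in> hecke_monoid" and Y: "Y \<in> {mat 1, S_mat}"
    using assms G18_hecke_words unfolding hecke_words_def by blast
  obtain a b c d where m': "m = mk2 a b c d" by (rule mk2_cases)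
  have "{a, b, c, d} \<subseteq> gap_reals"
    using hecke_monoid_gap[OF m] m' by (metis empty_subsetI insert_subset mk2_nth)
  then have "\<forall>x\<in>{a, b, c, d}. \<bar>x\<bar> < 1 \<longrightarrow> x = 0" by (auto simp: gap_reals_def)
  moreover have "\<exists>x\<in>{a, b, c, d}. \<bar>A $ i $ j\<bar> = \<bar>x\<bar>"
    using s X Y exhaust_2[of i] exhaust_2[of j]
    by (auto simp: A m' mat_1_mk2 S_mat_def)
  ultimately show ?thesis using assms(2) by force
qed

section \<open>The trace ring and parity\<close>

definition \<tau> :: real where "\<tau> = lambda18\<^sup>2"

lemma lambda18_bounds: "1 < lambda18" "lambda18 < 2"
proof -
  have "cos (pi / 3) < cos (pi / 18)"
    by (rule cos_monotone_0_pi) (use pi_gt_zero in auto)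
  then show "1 < lambda18" by (simp add: lambda18_def cos_60)
  have "cos (pi / 18) < cos 0"
    by (rule cos_monotone_0_pi) (use pi_gt_zero in auto)
  then show "lambda18 < 2" by (simp add: lambda18_def)
qed

text \<open>Tripling the angle pi/18 gives pi/6, whose doubled cosine is sqrt 3. Squaring the
  resulting cubic relation for \<open>lambda18\<close> leaves only even powers, hence a relation for
  \<open>\<tau>\<close>.\<close>

lemma \<tau>_cubic: "\<tau> ^ 3 = 6 * \<tau>\<^sup>2 - 9 * \<tau> + 3"
proof -
  have "cos (pi / 6) = cos (3 * (pi / 18))" by simp
  also have "\<dots> = 4 * cos (pi / 18) ^ 3 - 3 * cos (pi / 18)" by (rule cos_treble_cos)
  finally have "lambda18 ^ 3 - 3 * lambda18 = sqrt 3"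
    by (simp add: lambda18_def cos_30 power_mult_distrib)
  then have "(lambda18 ^ 3 - 3 * lambda18)\<^sup>2 = 3" by simp
  moreover have "(lambda18 ^ 3 - 3 * lambda18)\<^sup>2 =
      (lambda18\<^sup>2) ^ 3 - 6 * (lambda18\<^sup>2)\<^sup>2 + 9 * lambda18\<^sup>2"
    by (simp add: power2_eq_square power3_eq_cube algebra_simps)
  ultimately show ?thesis unfolding \<tau>_def by linarith
qed

text \<open>The ring Z[\<open>\<tau>\<close>], given by integer coordinates so that divisibility by
  2 can be decided by parity of integers. The cubic relation makes this span closed under
  products.\<close>

definition Zt :: "real set" where
  "Zt = {of_int a + of_int b * \<tau> + of_int c * \<tau>\<^sup>2 | a b c. True}"

lemma Zt_of_int: "of_int a + of_int b * \<tau> + of_int c * \<tau>\<^sup>2 \<in> Zt"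
  unfolding Zt_def by blast

lemma Zt_int [simp]: "of_int a \<in> Zt"
  using Zt_of_int[of a 0 0] by simp

lemma Zt_numeral [simp]: "0 \<in> Zt" "1 \<in> Zt" "numeral n \<in> Zt"
  using Zt_int[of 0] Zt_int[of 1] Zt_int[of "numeral n"] by simp_all

lemma Zt_\<tau> [simp]: "\<tau> \<in> Zt"
  using Zt_of_int[of 0 1 0] by simp

lemma Zt_add [simp]: assumes "x \<in> Zt" "y \<in> Zt" shows "x + y \<in> Zt"
proof -
  obtain a b c a' b' c' where "x = of_int a + of_int b * \<tau> + of_int c * \<tau>\<^sup>2"
    "y = of_int a' + of_int b' * \<tau> + of_int c' * \<tau>\<^sup>2"
    using assms unfolding Zt_def by blast
  then show ?thesis using Zt_of_int[of "a + a'" "b + b'" "c + c'"] by (simp add: algebra_simps)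
qed

lemma Zt_mult [simp]: assumes "x \<in> Zt" "y \<in> Zt" shows "x * y \<in> Zt"
proof -
  have *: "x * of_int n \<in> Zt" if x: "x \<in> Zt" for x n
  proof -
    obtain a b c where "x = of_int a + of_int b * \<tau> + of_int c * \<tau>\<^sup>2"
      using x unfolding Zt_def by blast
    then show ?thesis using Zt_of_int[of "a * n" "b * n" "c * n"] by (simp add: algebra_simps)
  qed
  have **: "x * \<tau> \<in> Zt" if x: "x \<in> Zt" for x
  proof -
    obtain a b c where eq: "x = of_int a + of_int b * \<tau> + of_int c * \<tau>\<^sup>2"
      using x unfolding Zt_def by blast
    have "x * \<tau> = of_int (3 * c) + of_int (a - 9 * c) * \<tau> + of_int (b + 6 * c) * \<tau>\<^sup>2"
      using \<tau>_cubic unfolding eq by simp algebra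
    then show ?thesis using Zt_of_int by presburger
  qed
  obtain a b c where "y = of_int a + of_int b * \<tau> + of_int c * \<tau>\<^sup>2"
    using assms unfolding Zt_def by blast
  then have "x * y = x * of_int a + x * \<tau> * of_int b + x * \<tau> * \<tau> * of_int c"
    by (simp add: algebra_simps power2_eq_square)
  then show ?thesis using assms(1) by (simp add: * **)
qed

lemma Zt_minus [simp]: "x \<in> Zt \<Longrightarrow> - x \<in> Zt"
  using Zt_mult[of "- 1" x] Zt_int[of "- 1"] by simp

lemma Zt_diff [simp]: "x \<in> Zt \<Longrightarrow> y \<in> Zt \<Longrightarrow> x - y \<in> Zt"
  using Zt_add[of x "- y"] by simp

lemma Zt_power [simp]: "x \<in> Zt \<Longrightarrow> x ^ n \<in> Zt"
  by (induction n) auto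

text \<open>The integer \<open>D\<close> below is the norm of \<open>2 z - \<tau>\<close>; it is odd because the norm of \<open>\<tau>\<close> is \<open>3\<close>.\<close>
lemma \<tau>_not_even: "z \<in> Zt \<Longrightarrow> \<tau> \<noteq> 2 * z"
proof
  assume "z \<in> Zt" and eq: "\<tau> = 2 * z"
  then obtain a b c where z: "z = of_int a + of_int b * \<tau> + of_int c * \<tau>\<^sup>2"
    unfolding Zt_def by blast
  \<comment> \<open>These are the coordinates of 2z - \<open>\<tau>\<close>. Multiplying the
    relation that they satisfy by \<open>\<tau>\<close> and by its square gives three linear
    equations for the nonzero vector (1, \<open>\<tau>\<close>, \<open>\<tau>\<close>^2), and
    \<open>D\<close> is their determinant.\<close>
  define C B A where "C = 2 * a" and "B = 2 * b - 1" and "A = 2 * c"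
  define D where "D = C * ((C - 9 * A) * (C + 27 * A + 6 * B) + (B + 6 * A) * (51 * A + 9 * B))
     - B * (3 * A * (C + 27 * A + 6 * B) - (B + 6 * A) * (3 * B + 18 * A))
     + A * (- 3 * A * (51 * A + 9 * B) - (C - 9 * A) * (3 * B + 18 * A))"
  have 0: "real_of_int C + B * \<tau> + A * \<tau>\<^sup>2 = 0"
    using eq unfolding z C_def B_def A_def by simp algebra
  have 1: "real_of_int (3 * A) + (C - 9 * A) * \<tau> + (B + 6 * A) * \<tau>\<^sup>2 = 0"
    using 0 \<tau>_cubic by simp algebra
  have 2: "real_of_int (3 * B + 18 * A) - (51 * A + 9 * B) * \<tau> + (C + 27 * A + 6 * B) * \<tau>\<^sup>2 = 0"
    using 1 \<tau>_cubic by simp algebra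
  have "real_of_int D = 0"
    using 0 1 2 unfolding D_def by simp algebra
  then have "D = 0" by linarith
  moreover have "odd D"
    unfolding D_def C_def B_def A_def by simp
  ultimately show False by simp
qed

section \<open>The grading of the Hecke group by parity of powers of lambda\<close>

text \<open>T has even powers of \<open>lambda18\<close> on the diagonal and odd powers off it, and
  S is of the opposite type. Since \<open>lambda18\<close> squared is \<open>\<tau>\<close>, these
  two types multiply like the integers modulo 2, which keeps the arithmetic inside \<open>Zt\<close>
  instead of Z[\<open>lambda18\<close>].\<close>

definition even_mats :: "mat2 set" where
  "even_mats = {mk2 a (lambda18 * b) (lambda18 * c) d | a b c d.
     a \<in> Zt \<and> b \<in> Zt \<and> c \<in> Zt \<and> d \<in> Zt}"

definition odd_mats :: "mat2 set" where
  "odd_mats = {mk2 (lambda18 * a) b c (lambda18 * d) | a b c d.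
     a \<in> Zt \<and> b \<in> Zt \<and> c \<in> Zt \<and> d \<in> Zt}"

lemma even_matsI:
  "a \<in> Zt \<Longrightarrow> b \<in> Zt \<Longrightarrow> c \<in> Zt \<Longrightarrow> d \<in> Zt \<Longrightarrow> b' = lambda18 * b \<Longrightarrow> c' = lambda18 * c \<Longrightarrow>
   mk2 a b' c' d \<in> even_mats"
  unfolding even_mats_def by blast

lemma odd_matsI:
  "a \<in> Zt \<Longrightarrow> b \<in> Zt \<Longrightarrow> c \<in> Zt \<Longrightarrow> d \<in> Zt \<Longrightarrow> a' = lambda18 * a \<Longrightarrow> d' = lambda18 * d \<Longrightarrow>
   mk2 a' b c d' \<in> odd_mats"
  unfolding odd_mats_def by blast

lemma lambda18_square: "lambda18 * (lambda18 * x) = \<tau> * x"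
  by (simp add: \<tau>_def power2_eq_square)

lemma even_odd_mats_mult:
  "A \<in> even_mats \<Longrightarrow> B \<in> even_mats \<Longrightarrow> A ** B \<in> even_mats"
  "A \<in> even_mats \<Longrightarrow> B \<in> odd_mats \<Longrightarrow> A ** B \<in> odd_mats"
  "A \<in> odd_mats \<Longrightarrow> B \<in> even_mats \<Longrightarrow> A ** B \<in> odd_mats"
  "A \<in> odd_mats \<Longrightarrow> B \<in> odd_mats \<Longrightarrow> A ** B \<in> even_mats"
proof -
  show "A ** B \<in> even_mats" if A: "A \<in> even_mats" and B: "B \<in> even_mats"
  proof -
    obtain a b c d where A: "A = mk2 a (lambda18 * b) (lambda18 * c) d"
      and R: "a \<in> Zt" "b \<in> Zt" "c \<in> Zt" "d \<in> Zt"
      using A unfolding even_mats_def by blast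
    obtain a' b' c' d' where B: "B = mk2 a' (lambda18 * b') (lambda18 * c') d'"
      and R': "a' \<in> Zt" "b' \<in> Zt" "c' \<in> Zt" "d' \<in> Zt"
      using B unfolding even_mats_def by blast
    have "A ** B = mk2 (a * a' + \<tau> * (b * c')) (lambda18 * (a * b' + b * d'))
        (lambda18 * (c * a' + d * c')) (\<tau> * (c * b') + d * d')"
      by (simp add: A B \<tau>_def algebra_simps power2_eq_square)
    then show ?thesis using R R' by (auto intro!: even_matsI[OF _ _ _ _ refl refl])
  qed
  show "A ** B \<in> odd_mats" if A: "A \<in> even_mats" and B: "B \<in> odd_mats"
  proof -
    obtain a b c d where A: "A = mk2 a (lambda18 * b) (lambda18 * c) d"
      and R: "a \<in> Zt" "b \<in> Zt" "c \<in> Zt" "d \<in> Zt"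
      using A unfolding even_mats_def by blast
    obtain a' b' c' d' where B: "B = mk2 (lambda18 * a') b' c' (lambda18 * d')"
      and R': "a' \<in> Zt" "b' \<in> Zt" "c' \<in> Zt" "d' \<in> Zt"
      using B unfolding odd_mats_def by blast
    have "A ** B = mk2 (lambda18 * (a * a' + b * c')) (a * b' + \<tau> * (b * d'))
        (\<tau> * (c * a') + d * c') (lambda18 * (c * b' + d * d'))"
      by (simp add: A B \<tau>_def algebra_simps power2_eq_square)
    then show ?thesis using R R' by (auto intro!: odd_matsI[OF _ _ _ _ refl refl])
  qed
  show "A ** B \<in> odd_mats" if A: "A \<in> odd_mats" and B: "B \<in> even_mats"
  proof -
    obtain a b c d where A: "A = mk2 (lambda18 * a) b c (lambda18 * d)"
      and R: "a \<in> Zt" "b \<in> Zt" "c \<in> Zt" "d \<in> Zt"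
      using A unfolding odd_mats_def by blast
    obtain a' b' c' d' where B: "B = mk2 a' (lambda18 * b') (lambda18 * c') d'"
      and R': "a' \<in> Zt" "b' \<in> Zt" "c' \<in> Zt" "d' \<in> Zt"
      using B unfolding even_mats_def by blast
    have "A ** B = mk2 (lambda18 * (a * a' + b * c')) (\<tau> * (a * b') + b * d')
        (c * a' + \<tau> * (d * c')) (lambda18 * (c * b' + d * d'))"
      by (simp add: A B \<tau>_def algebra_simps power2_eq_square)
    then show ?thesis using R R' by (auto intro!: odd_matsI[OF _ _ _ _ refl refl])
  qed
  show "A ** B \<in> even_mats" if A: "A \<in> odd_mats" and B: "B \<in> odd_mats"
  proof -
    obtain a b c d where A: "A = mk2 (lambda18 * a) b c (lambda18 * d)"
      and R: "a \<in> Zt" "b \<in> Zt" "c \<in> Zt" "d \<in> Zt"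
      using A unfolding odd_mats_def by blast
    obtain a' b' c' d' where B: "B = mk2 (lambda18 * a') b' c' (lambda18 * d')"
      and R': "a' \<in> Zt" "b' \<in> Zt" "c' \<in> Zt" "d' \<in> Zt"
      using B unfolding odd_mats_def by blast
    have "A ** B = mk2 (\<tau> * (a * a') + b * c') (lambda18 * (a * b' + b * d'))
        (lambda18 * (c * a' + d * c')) (c * b' + \<tau> * (d * d'))"
      by (simp add: A B \<tau>_def algebra_simps power2_eq_square)
    then show ?thesis using R R' by (auto intro!: even_matsI[OF _ _ _ _ refl refl])
  qed
qed

lemma even_odd_mats_inv:
  assumes "A \<in> SL2"
  shows "A \<in> even_mats \<Longrightarrow> matrix_inv A \<in> even_mats" "A \<in> odd_mats \<Longrightarrow> matrix_inv A \<in> odd_mats"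
proof -
  show "matrix_inv A \<in> even_mats" if A: "A \<in> even_mats"
  proof -
    obtain a b c d where A: "A = mk2 a (lambda18 * b) (lambda18 * c) d"
      and R: "a \<in> Zt" "b \<in> Zt" "c \<in> Zt" "d \<in> Zt"
      using A unfolding even_mats_def by blast
    have "matrix_inv A = mk2 d (- (lambda18 * b)) (- (lambda18 * c)) a"
      using assms unfolding A by (intro matrix_inv_mk2) (simp add: SL2_def)
    then show ?thesis using R by (auto intro: even_matsI[of _ "- b" "- c"])
  qed
  show "matrix_inv A \<in> odd_mats" if A: "A \<in> odd_mats"
  proof -
    obtain a b c d where A: "A = mk2 (lambda18 * a) b c (lambda18 * d)"
      and R: "a \<in> Zt" "b \<in> Zt" "c \<in> Zt" "d \<in> Zt"
      using A unfolding odd_mats_def by blast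
    have "matrix_inv A = mk2 (lambda18 * d) (- b) (- c) (lambda18 * a)"
      using assms unfolding A by (intro matrix_inv_mk2) (simp add: SL2_def)
    then show ?thesis using R by (auto intro: odd_matsI)
  qed
qed

lemma G18_even_odd: "G18 \<subseteq> even_mats \<union> odd_mats"
proof -
  have one: "mat 1 \<in> even_mats"
    unfolding mat_1_mk2 by (rule even_matsI[of _ 0 0]) auto
  have mult: "A ** B \<in> even_mats \<union> odd_mats"
    if "A \<in> even_mats \<union> odd_mats" "B \<in> even_mats \<union> odd_mats" for A B
    using that by (elim UnE) (simp_all add: even_odd_mats_mult)
  have inv: "matrix_inv A \<in> even_mats \<union> odd_mats"
    if "A \<in> SL2" "A \<in> even_mats \<union> odd_mats" for A
    using that(2) by (elim UnE) (simp_all add: even_odd_mats_inv that(1))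
  have "is_subgroup_SL2 (SL2 \<inter> (even_mats \<union> odd_mats))"
    unfolding is_subgroup_SL2_def
  proof (intro conjI ballI)
    show "A ** B \<in> SL2 \<inter> (even_mats \<union> odd_mats)"
      if "A \<in> SL2 \<inter> (even_mats \<union> odd_mats)" "B \<in> SL2 \<inter> (even_mats \<union> odd_mats)" for A B
      by (rule IntI) (use that SL2_mult mult in simp_all)
    show "matrix_inv A \<in> SL2 \<inter> (even_mats \<union> odd_mats)"
      if "A \<in> SL2 \<inter> (even_mats \<union> odd_mats)" for A
      by (rule IntI) (use that SL2_inv(3) inv in simp_all)
  qed (use SL2_1 one in simp_all)
  moreover have "S_mat \<in> odd_mats"
    unfolding S_mat_def by (rule odd_matsI[of 0 _ _ 0]) (use Zt_int[of "-1"] in simp_all)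
  moreover have "T18 \<in> even_mats"
    unfolding T18_def by (rule even_matsI[of _ 1 0]) simp_all
  ultimately have "G18 \<subseteq> SL2 \<inter> (even_mats \<union> odd_mats)"
    using S_mat_SL2 T18_SL2 by (intro G18_subset) simp_all
  then show ?thesis by simp
qed

text \<open>A conjugating element of odd type occurs twice, so its two contributions to the grading
  cancel.\<close>

lemma G18_conj_even:
  assumes "g \<in> G18" "A \<in> even_mats" shows "matrix_inv g ** A ** g \<in> even_mats"
proof -
  have "g \<in> even_mats \<or> g \<in> odd_mats" using assms(1) G18_even_odd by blast
  then show ?thesis
    using assms(2) by (elim disjE) (simp_all add: even_odd_mats_mult even_odd_mats_inv G18_SL2[OF assms(1)])
qed

section \<open>Powers, traces and rigidity of hyperbolic elements\<close>

primrec mpow :: "mat2 \<Rightarrow> nat \<Rightarrow> mat2" where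
  "mpow A 0 = mat 1"
| "mpow A (Suc n) = A ** mpow A n"

lemma mpow_add: "mpow A (m + n) = mpow A m ** mpow A n"
  by (induction m) (simp_all add: matrix_mul_assoc)

lemma mpow_in:
  assumes "mat 1 \<in> H" "\<And>A B. A \<in> H \<Longrightarrow> B \<in> H \<Longrightarrow> A ** B \<in> H" "A \<in> H"
  shows "mpow A n \<in> H"
  by (induction n) (simp_all add: assms)

lemma mpow_subgroup: "is_subgroup_SL2 H \<Longrightarrow> A \<in> H \<Longrightarrow> mpow A n \<in> H"
  by (rule mpow_in) (auto simp: is_subgroup_SL2_def)

lemma mpow_SL2: "A \<in> SL2 \<Longrightarrow> mpow A n \<in> SL2"
  by (rule mpow_subgroup[OF is_subgroup_SL2_SL2])

lemma mpow_G18: "A \<in> G18 \<Longrightarrow> mpow A n \<in> G18"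
  by (rule mpow_subgroup[OF is_subgroup_G18])

lemma mpow_eigen:
  assumes "A *v v = c *\<^sub>R v" shows "mpow A n *v v = c ^ n *\<^sub>R v"
proof (induction n)
  case (Suc n)
  have "mpow A (Suc n) *v v = A *v (mpow A n *v v)"
    by (simp add: matrix_vector_mul_assoc)
  then show ?case
    by (simp add: Suc assms matrix_vector_mult_scaleR mult.commute)
qed simp

lemma mpow_conj:
  assumes "g \<in> SL2"
  shows "mpow (g ** A ** matrix_inv g) n = g ** mpow A n ** matrix_inv g"
proof (induction n)
  case (Suc n)
  have "mpow (g ** A ** matrix_inv g) (Suc n) =
      g ** A ** (matrix_inv g ** g) ** mpow A n ** matrix_inv g"
    by (simp add: Suc matrix_mul_assoc)
  then show ?case by (simp add: SL2_inv(1)[OF assms] matrix_mul_assoc)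
qed (simp add: SL2_inv(2)[OF assms])

lemma mat2_distrib:
  fixes A B C :: mat2
  shows "(A + B) ** C = A ** C + B ** C" "C ** (A + B) = C ** A + C ** B"
    "(A - B) ** C = A ** C - B ** C" "C ** (A - B) = C ** A - C ** B"
proof -
  obtain a b c d where A: "A = mk2 a b c d" by (rule mk2_cases)
  obtain a' b' c' d' where B: "B = mk2 a' b' c' d'" by (rule mk2_cases)
  obtain p q r s where C: "C = mk2 p q r s" by (rule mk2_cases)
  show "(A + B) ** C = A ** C + B ** C" "C ** (A + B) = C ** A + C ** B"
    "(A - B) ** C = A ** C - B ** C" "C ** (A - B) = C ** A - C ** B"
    by (simp_all add: A B C algebra_simps)
qed

lemma cayley_hamilton_SL2:
  assumes "A \<in> SL2" shows "A ** A = trace A *\<^sub>R A - mat 1"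
proof -
  obtain a b c d where A: "A = mk2 a b c d" by (rule mk2_cases)
  show ?thesis using assms by (simp add: A SL2_def mat_1_mk2 algebra_simps)
qed

lemma trace_conj:
  fixes g A :: mat2
  assumes "g \<in> SL2" shows "trace (g ** A ** matrix_inv g) = trace A"
proof -
  have "trace (g ** A ** matrix_inv g) = trace (matrix_inv g ** (g ** A))"
    by (rule trace_mul_sym)
  then show ?thesis by (simp add: matrix_mul_assoc SL2_inv(1)[OF assms])
qed

lemma trace_scaleR_mat2: "trace (r *\<^sub>R (A :: mat2)) = r * trace A"
  by (simp add: trace_def sum_2 algebra_simps)

lemma trace_mpow_rec:
  assumes "A \<in> SL2"
  shows "trace (mpow A (Suc (Suc n))) = trace A * trace (mpow A (Suc n)) - trace (mpow A n)"
proof -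
  have "mpow A (Suc (Suc n)) = (A ** A) ** mpow A n"
    by (simp add: matrix_mul_assoc)
  also have "\<dots> = (trace A *\<^sub>R A - mat 1) ** mpow A n"
    unfolding cayley_hamilton_SL2[OF assms] ..
  finally have "mpow A (Suc (Suc n)) = trace A *\<^sub>R mpow A (Suc n) - mpow A n"
    by (simp add: mat2_distrib matrix_scaleR_mult_left)
  then show ?thesis by (simp only: trace_sub trace_scaleR_mat2)
qed

lemma trace_mpow_eigen:
  assumes "A \<in> SL2" "trace A = x + inverse x" "x \<noteq> 0"
  shows "trace (mpow A n) = x ^ n + inverse x ^ n"
proof (induction n rule: induct_nat_012)
  case 0
  then show ?case by (simp add: mat_1_mk2)
next
  case 1
  then show ?case by (simp add: assms)
next
  case (ge2 n)
  show ?case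
    unfolding trace_mpow_rec[OF assms(1)] ge2 assms(2)
    using assms(3) by (simp add: field_simps)
qed

text \<open>The recurrence for traces of powers starts from 2 and \<open>trace A\<close>, both even,
  and its coefficients lie in \<open>Zt\<close>.\<close>

lemma trace_mpow_even:
  assumes "A \<in> SL2" "trace A = 2 * z" "z \<in> Zt"
  shows "\<exists>w\<in>Zt. trace (mpow A n) = 2 * w"
proof (induction n rule: induct_nat_012)
  case 0
  then show ?case by (auto simp: mat_1_mk2 intro!: bexI[of _ 1])
next
  case 1
  then show ?case using assms by auto
next
  case (ge2 n)
  then obtain w w' where "w \<in> Zt" "w' \<in> Zt" "trace (mpow A n) = 2 * w" "trace (mpow A (Suc n)) = 2 * w'"
    by auto
  then show ?case
    using assms by (intro bexI[of _ "2 * z * w' - w"]) (simp_all add: trace_mpow_rec del: mpow.simps)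
qed

section \<open>Parabolic stabilizers and rigidity of a hyperbolic element with given
  eigenvector\<close>

text \<open>The rank one nilpotent matrix of the map sending \<open>u\<close> to the multiple \<open>v \<and> u\<close> of \<open>v\<close>.\<close>
definition nil2 :: "real^2 \<Rightarrow> mat2" where
  "nil2 v = mk2 (- (v $ 1 * v $ 2)) ((v $ 1)\<^sup>2) (- ((v $ 2)\<^sup>2)) (v $ 1 * v $ 2)"

lemma nil2_scaleR: "nil2 (c *\<^sub>R v) = c\<^sup>2 *\<^sub>R nil2 v"
  by (simp add: nil2_def power2_eq_square algebra_simps)

lemma nil2_conj:
  assumes "g \<in> SL2" shows "g ** nil2 v ** matrix_inv g = nil2 (g *v v)"
proof -
  obtain a b c d where g: "g = mk2 a b c d" by (rule mk2_cases)
  have D: "a * d - b * c = 1" using assms by (simp add: g SL2_def)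
  show ?thesis unfolding g matrix_inv_mk2[OF D]
    by (simp add: nil2_def power2_eq_square algebra_simps)
qed

text \<open>The inverse of K fixes v as well, which is what \<open>e3\<close> and \<open>e4\<close>
  say. With \<open>e1\<close> and \<open>e2\<close> this determines all entries of K from one
  off-diagonal entry, chosen according to which coordinate of v is nonzero.\<close>

lemma SL2_fixing_vector:
  assumes "K \<in> SL2" "v \<noteq> 0" "K *v v = v"
  shows "\<exists>\<kappa>. K = mat 1 + \<kappa> *\<^sub>R nil2 v"
proof -
  obtain a b c d where K: "K = mk2 a b c d" by (rule mk2_cases)
  define x y where "x = v $ 1" and "y = v $ 2"
  have D: "a * d - b * c = 1" using assms(1) by (simp add: K SL2_def)
  have e1: "a * x + b * y = x" and e2: "c * x + d * y = y"
    using arg_cong[OF assms(3), of "\<lambda>u. u $ 1"] arg_cong[OF assms(3), of "\<lambda>u. u $ 2"]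
    by (simp_all add: K x_def y_def)
  have "d * x - b * y = d * (a * x + b * y) - b * (c * x + d * y)" by (simp only: e1 e2)
  also have "\<dots> = (a * d - b * c) * x" by (simp add: algebra_simps)
  finally have e3: "d * x - b * y = x" by (simp add: D)
  have "a * y - c * x = a * (c * x + d * y) - c * (a * x + b * y)" by (simp only: e1 e2)
  also have "\<dots> = (a * d - b * c) * y" by (simp add: algebra_simps)
  finally have e4: "a * y - c * x = y" by (simp add: D)
  have "x \<noteq> 0 \<or> y \<noteq> 0" using assms(2) by (auto simp: vec_eq_iff forall_2 x_def y_def)
  then show ?thesis
  proof
    assume x: "x \<noteq> 0"
    define \<kappa> where "\<kappa> = b / x\<^sup>2"
    have b: "b = \<kappa> * x\<^sup>2" using x by (simp add: \<kappa>_def)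
    have "x * a = x * (1 - \<kappa> * (x * y))" using e1 unfolding b by (simp add: power2_eq_square algebra_simps)
    then have a: "a = 1 - \<kappa> * (x * y)" using x by simp
    have "x * d = x * (1 + \<kappa> * (x * y))" using e3 unfolding b by (simp add: power2_eq_square algebra_simps)
    then have d: "d = 1 + \<kappa> * (x * y)" using x by simp
    have "x * c = x * (- \<kappa> * y\<^sup>2)" using e2 unfolding d by (simp add: power2_eq_square algebra_simps)
    then have c: "c = - \<kappa> * y\<^sup>2" using x by (metis mult_left_cancel)
    show ?thesis
      by (rule exI[of _ \<kappa>]) (simp add: K nil2_def mat_1_mk2 a b c d flip: x_def y_def)
  next
    assume y: "y \<noteq> 0"
    define \<kappa> where "\<kappa> = - c / y\<^sup>2"
    have c: "c = - \<kappa> * y\<^sup>2" using y by (simp add: \<kappa>_def)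
    have "y * d = y * (1 + \<kappa> * (x * y))" using e2 unfolding c by (simp add: power2_eq_square algebra_simps)
    then have d: "d = 1 + \<kappa> * (x * y)" using y by simp
    have "y * a = y * (1 - \<kappa> * (x * y))" using e4 unfolding c by (simp add: power2_eq_square algebra_simps)
    then have a: "a = 1 - \<kappa> * (x * y)" using y by simp
    have "y * b = y * (\<kappa> * x\<^sup>2)" using e1 unfolding a by (simp add: power2_eq_square algebra_simps)
    then have b: "b = \<kappa> * x\<^sup>2" using y by simp
    show ?thesis
      by (rule exI[of _ \<kappa>]) (simp add: K nil2_def mat_1_mk2 a b c d flip: x_def y_def)
  qed
qed

lemma power_inverse_small:
  fixes \<mu> r :: real
  assumes "\<mu> > 1" obtains i where "\<bar>r * inverse \<mu> ^ i\<bar> < 1"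
proof -
  have "(\<lambda>i. r * inverse \<mu> ^ i) \<longlonglongrightarrow> r * 0"
    using assms by (intro tendsto_mult tendsto_const LIMSEQ_power_zero) (simp add: inverse_less_1_iff)
  then have "\<forall>\<^sub>F i in sequentially. dist (r * inverse \<mu> ^ i) (r * 0) < 1"
    by (rule tendstoD) simp
  then obtain i where "dist (r * inverse \<mu> ^ i) (r * 0) < 1"
    unfolding eventually_sequentially by blast
  then show ?thesis by (intro that[of i]) (simp add: dist_real_def)
qed

text \<open>The quotient \<open>K\<close> of \<open>H\<close> and \<open>A\<close> is parabolic, and its conjugates under powers of \<open>A\<close> tend to
  the identity, which contradicts discreteness unless \<open>K\<close> is the identity.\<close>
lemma G18_hyperbolic_unique:
  assumes A: "A \<in> G18" and H: "H \<in> G18" and v: "v \<noteq> 0"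
    and Av: "A *v v = \<mu> *\<^sub>R v" and Hv: "H *v v = \<mu> *\<^sub>R v" and \<mu>: "\<mu> > 1"
  shows "H = A"
proof -
  let ?A' = "matrix_inv A"
  note A_SL2 = G18_SL2[OF A]
  have inv_v: "?A' *v v = inverse \<mu> *\<^sub>R v"
  proof -
    have "?A' *v (A *v v) = v"
      by (simp add: matrix_vector_mul_assoc SL2_inv(1)[OF A_SL2])
    then have "\<mu> *\<^sub>R (?A' *v v) = v" by (simp add: Av matrix_vector_mult_scaleR)
    then have "inverse \<mu> *\<^sub>R v = inverse \<mu> *\<^sub>R (\<mu> *\<^sub>R (?A' *v v))" by simp
    then show ?thesis using \<mu> by simp
  qed
  define K where "K = ?A' ** H"
  have K: "K \<in> G18" unfolding K_def by (intro G18_mult G18_inv A H)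
  have "K *v v = ?A' *v (H *v v)" by (simp add: K_def matrix_vector_mul_assoc)
  then have "K *v v = v"
    using \<mu> by (simp add: Hv inv_v matrix_vector_mult_scaleR)
  then obtain \<kappa> where \<kappa>: "K = mat 1 + \<kappa> *\<^sub>R nil2 v"
    using SL2_fixing_vector[OF G18_SL2[OF K] v] by blast
  have conj: "mat 1 + (\<kappa> * inverse (\<mu>\<^sup>2) ^ i) *\<^sub>R nil2 v \<in> G18" for i
  proof (induction i)
    case (Suc i)
    \<comment> \<open>\<open>nil2\<close> is quadratic in the vector, and the inverse of A scales v
      by 1/mu, so conjugation scales \<open>nil2 v\<close> by mu^(-2).\<close>
    have "?A' ** nil2 v ** A = inverse (\<mu>\<^sup>2) *\<^sub>R nil2 v"
      using nil2_conj[OF SL2_inv(3)[OF A_SL2], of v]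
      by (simp add: SL2_inv_inv A_SL2 inv_v nil2_scaleR power_inverse)
    then have "?A' ** (mat 1 + (\<kappa> * inverse (\<mu>\<^sup>2) ^ i) *\<^sub>R nil2 v) ** A =
        mat 1 + (\<kappa> * inverse (\<mu>\<^sup>2) ^ Suc i) *\<^sub>R nil2 v"
      by (simp add: mat2_distrib matrix_scaleR_mult_left
          matrix_scaleR_mult_right SL2_inv(1)[OF A_SL2] mult.assoc)
    moreover have "?A' ** (mat 1 + (\<kappa> * inverse (\<mu>\<^sup>2) ^ i) *\<^sub>R nil2 v) ** A \<in> G18"
      by (intro G18_mult G18_inv A Suc)
    ultimately show ?case by simp
  qed (use K \<kappa> in simp)
  have \<mu>2: "\<mu>\<^sup>2 > 1" using \<mu> by (simp add: one_less_power)
  \<comment> \<open>Only off-diagonal entries are used, where the identity contributes nothing. They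
    become smaller than 1 for large i, so by the entry gap they vanish, and with them the factor
    independent of i.\<close>
  have zero: "\<kappa> * r = 0"
    if entry: "\<And>i. \<exists>j k. (mat 1 + (\<kappa> * inverse (\<mu>\<^sup>2) ^ i) *\<^sub>R nil2 v) $ j $ k = \<kappa> * inverse (\<mu>\<^sup>2) ^ i * r"
    for r
  proof -
    obtain i where i: "\<bar>\<kappa> * r * inverse (\<mu>\<^sup>2) ^ i\<bar> < 1"
      using power_inverse_small[OF \<mu>2] by blast
    obtain j k where "(mat 1 + (\<kappa> * inverse (\<mu>\<^sup>2) ^ i) *\<^sub>R nil2 v) $ j $ k = \<kappa> * inverse (\<mu>\<^sup>2) ^ i * r"
      using entry by blast
    with i have "\<kappa> * inverse (\<mu>\<^sup>2) ^ i * r = 0"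
      using G18_entry_gap[OF conj[of i], of j k] by (simp add: mult_ac)
    then show ?thesis using \<mu> by auto
  qed
  have "\<kappa> * (v $ 1)\<^sup>2 = 0"
    by (rule zero, rule exI[of _ 1], rule exI[of _ 2]) (simp add: nil2_def mat_1_mk2)
  moreover have "\<kappa> * - ((v $ 2)\<^sup>2) = 0"
    by (rule zero, rule exI[of _ 2], rule exI[of _ 1]) (simp add: nil2_def mat_1_mk2)
  ultimately have "\<kappa> = 0" using v by (auto simp: vec_eq_iff forall_2)
  then have "A ** K = A" using \<kappa> by simp
  then show ?thesis by (simp add: K_def matrix_mul_assoc SL2_inv(2)[OF A_SL2])
qed

section \<open>The family of special hyperbolic elements\<close>

text \<open>This bound makes the square root 1 - 6\<open>\<tau>\<close> + 2\<open>\<tau>\<close>^2 =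
  1 + 2\<open>\<tau>\<close>(\<open>\<tau>\<close> - 3) positive, so that \<open>\<xi>\<close> is
  the larger of the two eigenvalues.\<close>

lemma \<tau>_gt_3: "\<tau> > 3"
proof -
  have "cos (pi / 6) < cos (pi / 18)"
    by (rule cos_monotone_0_pi) (use pi_gt_zero in auto)
  then have "sqrt 3 < lambda18" by (simp add: lambda18_def cos_30)
  then have "(sqrt 3)\<^sup>2 < lambda18\<^sup>2" by (intro power_strict_mono) auto
  then show ?thesis by (simp add: \<tau>_def)
qed

lemma sqrt_4_\<tau>_square_plus_1: "(1 - 6 * \<tau> + 2 * \<tau>\<^sup>2)\<^sup>2 = 4 * \<tau>\<^sup>2 + 1"
proof -
  have "(1 - 6 * \<tau> + 2 * \<tau>\<^sup>2)\<^sup>2 - (4 * \<tau>\<^sup>2 + 1) = 4 * \<tau> * (\<tau> ^ 3 - (6 * \<tau>\<^sup>2 - 9 * \<tau> + 3))"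
    by (simp add: power2_eq_square power3_eq_cube algebra_simps)
  then show ?thesis using \<tau>_cubic by simp
qed

text \<open>For the trace 2 + 16\<open>\<tau>\<close>^2 the discriminant of the characteristic
  polynomial is 64\<open>\<tau>\<close>^2(4\<open>\<tau>\<close>^2 + 1). Its square root is
  8\<open>\<tau>\<close> times the root of 4\<open>\<tau>\<close>^2 + 1 found above, and
  \<open>\<xi>\<close> is the root of the polynomial with the plus sign.\<close>

definition \<xi> :: real where "\<xi> = 1 + 8 * \<tau>\<^sup>2 + 4 * \<tau> * (1 - 6 * \<tau> + 2 * \<tau>\<^sup>2)"

lemma \<xi>_Zt: "\<xi> \<in> Zt" and inverse_\<xi>_Zt: "inverse \<xi> \<in> Zt"
  and \<xi>_gt_1: "\<xi> > 1" and \<xi>_trace: "\<xi> + inverse \<xi> = 2 + 16 * \<tau>\<^sup>2"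
proof -
  let ?y = "1 - 6 * \<tau> + 2 * \<tau>\<^sup>2"
  define \<xi>' where "\<xi>' = 1 + 8 * \<tau>\<^sup>2 - 4 * \<tau> * ?y"
  show "\<xi> \<in> Zt" unfolding \<xi>_def by simp
  have "\<xi> * \<xi>' = (1 + 8 * \<tau>\<^sup>2)\<^sup>2 - 16 * \<tau>\<^sup>2 * ?y\<^sup>2"
    unfolding \<xi>_def \<xi>'_def by (simp only: power2_eq_square) (simp add: algebra_simps)
  also have "\<dots> = 1"
    unfolding sqrt_4_\<tau>_square_plus_1 by (simp add: power2_eq_square algebra_simps)
  finally have inv: "inverse \<xi> = \<xi>'" by (rule inverse_unique)
  show "inverse \<xi> \<in> Zt" unfolding inv \<xi>'_def by simp
  show "\<xi> + inverse \<xi> = 2 + 16 * \<tau>\<^sup>2" unfolding inv by (simp add: \<xi>_def \<xi>'_def)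
  have "\<tau> * (\<tau> - 3) > 0" using \<tau>_gt_3 by simp
  then have "?y > 0" by (simp add: power2_eq_square algebra_simps)
  then have "4 * \<tau> * ?y > 0" using \<tau>_gt_3 by simp
  moreover have "\<tau>\<^sup>2 > 0" using \<tau>_gt_3 by simp
  ultimately show "\<xi> > 1" unfolding \<xi>_def by linarith
qed

section \<open>The matrices B, P, C and the traces of the words W\<close>

definition L18 :: mat2 where "L18 = mk2 1 0 lambda18 1"

lemma L18_G18: "L18 \<in> G18"
proof -
  have "L18 = S_mat ** matrix_inv T18 ** matrix_inv S_mat"
    by (simp add: L18_def T18_inv_mk2 S_mat_def matrix_inv_mk2)
  then show ?thesis using S_mat_G18 T18_G18 by (metis G18_mult G18_inv)
qed

lemma mpow_unipotent:
  "mpow (mk2 1 b 0 1) n = mk2 1 (n * b) 0 1" "mpow (mk2 1 0 c 1) n = mk2 1 0 (n * c) 1"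
  by (induction n) (simp_all add: mat_1_mk2 algebra_simps)

definition P18 :: mat2 where "P18 = mk2 (1 - \<tau>) lambda18 (- (lambda18 * \<tau>)) (1 + \<tau>)"
definition B18 :: mat2 where
  "B18 = mk2 (1 - 2 * \<tau> + 16 * \<tau>\<^sup>2) (lambda18 * (6 + 16 * \<tau>)) (lambda18 * (2 * \<tau>)) (1 + 2 * \<tau>)"
definition C18 :: mat2 where
  "C18 = mk2 (1 - 2 * \<tau>) (lambda18 * (6 - 16 * \<tau>)) (lambda18 * (2 * \<tau>)) (1 + 2 * \<tau> + 16 * \<tau>\<^sup>2)"

lemma P18_G18: "P18 \<in> G18" and B18_G18: "B18 \<in> G18" and C18_G18: "C18 \<in> G18"
proof -
  have L_inv: "matrix_inv L18 = mk2 1 0 (- lambda18) 1" by (simp add: L18_def matrix_inv_mk2)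
  have "P18 = L18 ** T18 ** matrix_inv L18"
    unfolding L_inv by (simp add: L18_def T18_def P18_def \<tau>_def power2_eq_square algebra_simps)
  then show "P18 \<in> G18" by (metis G18_mult G18_inv L18_G18 T18_G18)
  define Q where "Q = matrix_inv L18 ** mpow (matrix_inv T18) 2 ** L18"
  have T8: "mpow T18 8 = mk2 1 (8 * lambda18) 0 1" by (simp only: T18_def mpow_unipotent) simp
  have T2: "mpow (matrix_inv T18) 2 = mk2 1 (- 2 * lambda18) 0 1"
    by (simp only: T18_inv_mk2 mpow_unipotent) simp
  have Q: "Q \<in> G18" unfolding Q_def by (intro G18_mult G18_inv mpow_G18 L18_G18 T18_G18)
  have "B18 = mpow T18 8 ** Q" "C18 = Q ** mpow T18 8"
    unfolding Q_def T8 T2 L_inv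
    by (simp_all add: L18_def B18_def C18_def \<tau>_def power2_eq_square algebra_simps)
  then show "B18 \<in> G18" "C18 \<in> G18" using Q T18_G18 by (metis G18_mult mpow_G18)+
qed

lemma trace_B18: "trace B18 = 2 + 16 * \<tau>\<^sup>2" and trace_C18: "trace C18 = trace B18"
  by (simp_all add: B18_def C18_def)

definition W18 :: "nat \<Rightarrow> mat2" where "W18 n = mpow B18 n ** P18 ** mpow C18 n"

lemma W18_G18: "W18 n \<in> G18"
  unfolding W18_def by (intro G18_mult mpow_G18 B18_G18 P18_G18 C18_G18)

text \<open>\<open>B18\<close> and \<open>C18\<close> have the same characteristic polynomial, so
  Cayley-Hamilton reduces their powers with the same coefficients.\<close>

lemma mpow_B18_C18:
  "\<exists>u v. mpow B18 n = u *\<^sub>R B18 + v *\<^sub>R mat 1 \<and> mpow C18 n = u *\<^sub>R C18 + v *\<^sub>R mat 1"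
proof (induction n)
  case 0
  show ?case by (rule exI[of _ 0], rule exI[of _ 1]) simp
next
  case (Suc n)
  then obtain u v where uv: "mpow B18 n = u *\<^sub>R B18 + v *\<^sub>R mat 1"
    "mpow C18 n = u *\<^sub>R C18 + v *\<^sub>R mat 1" by blast
  have "mpow A (Suc n) = (u * trace B18 + v) *\<^sub>R A + (- u) *\<^sub>R mat 1"
    if "mpow A n = u *\<^sub>R A + v *\<^sub>R mat 1" "A \<in> SL2" "trace A = trace B18" for A
  proof -
    have "mpow A (Suc n) = u *\<^sub>R (A ** A) + v *\<^sub>R A"
      by (simp add: that(1) mat2_distrib matrix_scaleR_mult_right)
    then show ?thesis
      unfolding cayley_hamilton_SL2[OF that(2)] that(3) by (simp add: algebra_simps)
  qed
  then show ?case
    using uv G18_SL2 B18_G18 C18_G18 trace_C18 by blast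
qed

text \<open>In \<open>trace (W18 n)\<close> the powers of \<open>B18\<close> and \<open>C18\<close> are the same linear combinations of the matrix
  and the identity, so the claim reduces to the identities
  \<open>tr (B P C) = tr (B B)\<close> and \<open>tr (B P) + tr (P C) = 2 tr B\<close>.\<close>
lemma trace_W18: "trace (W18 n) = trace (mpow B18 (2 * n))"
proof -
  obtain u v where uv: "mpow B18 n = u *\<^sub>R B18 + v *\<^sub>R mat 1" "mpow C18 n = u *\<^sub>R C18 + v *\<^sub>R mat 1"
    using mpow_B18_C18 by blast
  have eq: "trace (B18 ** P18 ** C18) = trace (B18 ** B18)"
    "trace (B18 ** P18) + trace (P18 ** C18) = 2 * trace B18" "trace P18 = trace (mat 1 :: mat2)"
    by (simp_all add: B18_def P18_def C18_def mat_1_mk2 algebra_simps power2_eq_square lambda18_square)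
  have "W18 n = u\<^sup>2 *\<^sub>R (B18 ** P18 ** C18) + (u * v) *\<^sub>R (B18 ** P18 + P18 ** C18) + v\<^sup>2 *\<^sub>R P18"
    unfolding W18_def uv
    by (simp add: mat2_distrib matrix_scaleR_mult_right matrix_scaleR_mult_left
        power2_eq_square algebra_simps)
  then have "trace (W18 n) = u\<^sup>2 * trace (B18 ** P18 ** C18)
      + u * v * (trace (B18 ** P18) + trace (P18 ** C18)) + v\<^sup>2 * trace P18"
    by (simp only: trace_add trace_scaleR_mat2)
  also have "\<dots> = u\<^sup>2 * trace (B18 ** B18) + 2 * u * v * trace B18 + v\<^sup>2 * trace (mat 1 :: mat2)"
    unfolding eq by simp
  also have "\<dots> = trace (mpow B18 n ** mpow B18 n)"
  proof -
    have "mpow B18 n ** mpow B18 n = u\<^sup>2 *\<^sub>R (B18 ** B18) + ((u * v) *\<^sub>R B18 + (u * v) *\<^sub>R B18)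
        + v\<^sup>2 *\<^sub>R mat 1"
      unfolding uv
      by (simp add: mat2_distrib matrix_scaleR_mult_right matrix_scaleR_mult_left
          power2_eq_square algebra_simps)
    then show ?thesis by (simp only: trace_add trace_scaleR_mat2)
  qed
  finally show ?thesis by (simp add: mpow_add mult_2)
qed

lemma trace_W18_\<xi>: "trace (W18 n) = \<xi> ^ (2 * n) + inverse (\<xi> ^ (2 * n))"
  using trace_mpow_eigen[OF G18_SL2[OF B18_G18], of \<xi> "2 * n"] \<xi>_gt_1 \<xi>_trace
  by (simp add: trace_W18 trace_B18 power_inverse)

section \<open>Congruences modulo 2\<close>

lemma even_mats_ring:
  "A \<in> even_mats \<Longrightarrow> B \<in> even_mats \<Longrightarrow> A + B \<in> even_mats"
  "A \<in> even_mats \<Longrightarrow> r \<in> Zt \<Longrightarrow> r *\<^sub>R A \<in> even_mats"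
  "A \<in> even_mats \<Longrightarrow> trace A \<in> Zt"
  "A \<in> even_mats \<Longrightarrow> \<exists>c\<in>Zt. A $ 2 $ 1 = lambda18 * c"
proof -
  show "A + B \<in> even_mats" if A: "A \<in> even_mats" and B: "B \<in> even_mats"
  proof -
    obtain a b c d where "A = mk2 a (lambda18 * b) (lambda18 * c) d"
      "a \<in> Zt" "b \<in> Zt" "c \<in> Zt" "d \<in> Zt"
      using A unfolding even_mats_def by blast
    moreover obtain a' b' c' d' where "B = mk2 a' (lambda18 * b') (lambda18 * c') d'"
      "a' \<in> Zt" "b' \<in> Zt" "c' \<in> Zt" "d' \<in> Zt"
      using B unfolding even_mats_def by blast
    ultimately show ?thesis
      by (auto intro!: even_matsI[of _ "b + b'" "c + c'"] simp: algebra_simps)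
  qed
  assume "A \<in> even_mats"
  then obtain a b c d where A: "A = mk2 a (lambda18 * b) (lambda18 * c) d"
      "a \<in> Zt" "b \<in> Zt" "c \<in> Zt" "d \<in> Zt"
    unfolding even_mats_def by blast
  show "trace A \<in> Zt" "\<exists>c\<in>Zt. A $ 2 $ 1 = lambda18 * c" using A by auto
  show "r *\<^sub>R A \<in> even_mats" if "r \<in> Zt"
    using A that by (auto intro!: even_matsI[of _ "r * b" "r * c"])
qed

lemma even_mats_1: "mat 1 \<in> even_mats"
  unfolding mat_1_mk2 by (rule even_matsI[of _ 0 0]) auto

text \<open>Congruence is taken inside the ring \<open>even_mats\<close>, so an off-diagonal entry
  must be 2 \<open>lambda18\<close> times an element of \<open>Zt\<close>.\<close>

definition id_mod_2 :: "mat2 set" where "id_mod_2 = {mat 1 + 2 *\<^sub>R E | E. E \<in> even_mats}"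

lemma id_mod_2_mpow:
  assumes "A \<in> id_mod_2" shows "mpow A n \<in> id_mod_2"
proof (rule mpow_in[OF _ _ assms])
  have "0 *\<^sub>R mat 1 \<in> even_mats" by (intro even_mats_ring even_mats_1) simp
  then show "mat 1 \<in> id_mod_2" unfolding id_mod_2_def by force
  fix A B assume "A \<in> id_mod_2" "B \<in> id_mod_2"
  then obtain E F where EF: "E \<in> even_mats" "F \<in> even_mats"
    "A = mat 1 + 2 *\<^sub>R E" "B = mat 1 + 2 *\<^sub>R F"
    unfolding id_mod_2_def by blast
  have "A ** B = mat 1 + 2 *\<^sub>R (E + F + 2 *\<^sub>R (E ** F))"
    by (simp add: EF mat2_distrib matrix_scaleR_mult_right matrix_scaleR_mult_left algebra_simps)
  moreover have "E + F + 2 *\<^sub>R (E ** F) \<in> even_mats"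
    by (intro even_mats_ring even_odd_mats_mult EF) simp
  ultimately show "A ** B \<in> id_mod_2" unfolding id_mod_2_def by blast
qed

text \<open>Both matrices are products of conjugates of even powers of unipotent elements, and such
  powers are the identity modulo 2.\<close>

lemma B18_id_mod_2: "B18 \<in> id_mod_2" and C18_id_mod_2: "C18 \<in> id_mod_2"
proof -
  have "B18 = mat 1 + 2 *\<^sub>R mk2 (8 * \<tau>\<^sup>2 - \<tau>) (lambda18 * (3 + 8 * \<tau>)) (lambda18 * \<tau>) \<tau>"
    "C18 = mat 1 + 2 *\<^sub>R mk2 (- \<tau>) (lambda18 * (3 - 8 * \<tau>)) (lambda18 * \<tau>) (\<tau> + 8 * \<tau>\<^sup>2)"
    by (simp_all add: B18_def C18_def mat_1_mk2 algebra_simps)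
  then show "B18 \<in> id_mod_2" "C18 \<in> id_mod_2"
    unfolding id_mod_2_def by (blast intro!: even_matsI[OF _ _ _ _ refl refl] Zt_add Zt_diff Zt_mult Zt_minus Zt_power Zt_\<tau> Zt_numeral)+
qed

lemma P18_even: "P18 \<in> even_mats"
  unfolding P18_def by (rule even_matsI[of _ 1 "- \<tau>"]) auto

lemma W18_mod_2: "\<exists>E\<in>even_mats. W18 n = P18 + 2 *\<^sub>R E"
proof -
  obtain E F where EF: "E \<in> even_mats" "F \<in> even_mats"
    "mpow B18 n = mat 1 + 2 *\<^sub>R E" "mpow C18 n = mat 1 + 2 *\<^sub>R F"
    using id_mod_2_mpow[OF B18_id_mod_2, of n] id_mod_2_mpow[OF C18_id_mod_2, of n]
    unfolding id_mod_2_def by blast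
  have "W18 n = P18 + 2 *\<^sub>R (E ** P18 + P18 ** F + 2 *\<^sub>R (E ** P18 ** F))"
    by (simp add: W18_def EF mat2_distrib matrix_scaleR_mult_right matrix_scaleR_mult_left algebra_simps)
  moreover have "E ** P18 + P18 ** F + 2 *\<^sub>R (E ** P18 ** F) \<in> even_mats"
    by (intro even_mats_ring even_odd_mats_mult EF P18_even) simp
  ultimately show ?thesis by blast
qed

lemma W18_even: "W18 n \<in> even_mats"
proof -
  obtain E where "E \<in> even_mats" "W18 n = P18 + 2 *\<^sub>R E" using W18_mod_2 by blast
  then show ?thesis using P18_even by (simp add: even_mats_ring)
qed

text \<open>The unipotent \<open>P18\<close> has trace 2, so reduction modulo 2 kills the trace
  although it does not kill \<open>P18\<close> off the diagonal.\<close>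

lemma trace_W18_even: "\<exists>z\<in>Zt. trace (W18 n) = 2 * z"
proof -
  obtain E where E: "E \<in> even_mats" "W18 n = P18 + 2 *\<^sub>R E" using W18_mod_2 by blast
  have "trace (W18 n) = trace P18 + 2 * trace E"
    unfolding E(2) by (simp only: trace_add trace_scaleR_mat2)
  then have "trace (W18 n) = 2 * (1 + trace E)" by (simp add: P18_def)
  then show ?thesis using even_mats_ring(3)[OF E(1)] by (intro bexI[of _ "1 + trace E"]) auto
qed

lemma W18_lower_left: "\<exists>z\<in>Zt. W18 n $ 2 $ 1 = lambda18 * (2 * z - \<tau>)"
proof -
  obtain E where E: "E \<in> even_mats" "W18 n = P18 + 2 *\<^sub>R E" using W18_mod_2 by blast
  then obtain c where "c \<in> Zt" "E $ 2 $ 1 = lambda18 * c" using even_mats_ring(4) by blast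
  then show ?thesis by (auto simp: E(2) P18_def algebra_simps)
qed

lemma W18_not_conj_even_power:
  assumes g: "g \<in> G18" and conj: "W18 n = matrix_inv g ** mpow (W18 m) (2 * s) ** g"
  shows False
proof -
  define Z where "Z = mpow (W18 m) s"
  have Z: "Z \<in> G18" unfolding Z_def by (intro mpow_G18 W18_G18)
  have "Z \<in> even_mats" unfolding Z_def
    by (intro mpow_in even_mats_1 even_odd_mats_mult W18_even)
  then have "matrix_inv g ** Z ** g \<in> even_mats" by (rule G18_conj_even[OF g])
  then obtain c where c: "c \<in> Zt" "(matrix_inv g ** Z ** g) $ 2 $ 1 = lambda18 * c"
    using even_mats_ring(4) by blast
  obtain w where w: "w \<in> Zt" "trace Z = 2 * w"
    using trace_W18_even trace_mpow_even[OF G18_SL2[OF W18_G18]] unfolding Z_def by metis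
  have "W18 n = matrix_inv g ** (Z ** Z) ** g"
    by (simp add: conj Z_def mult_2 mpow_add)
  also have "\<dots> = trace Z *\<^sub>R (matrix_inv g ** Z ** g) - mat 1"
    unfolding cayley_hamilton_SL2[OF G18_SL2[OF Z]]
    by (simp add: mat2_distrib matrix_scaleR_mult_right matrix_scaleR_mult_left SL2_inv(1)[OF G18_SL2[OF g]])
  \<comment> \<open>The lower left entry does not see the subtracted identity, so the even factor
    \<open>trace Z\<close> divides it.\<close>
  finally have "W18 n $ 2 $ 1 = 2 * w * (lambda18 * c)"
    by (simp add: c w mat_1_mk2)
  moreover obtain z where z: "z \<in> Zt" "W18 n $ 2 $ 1 = lambda18 * (2 * z - \<tau>)"
    using W18_lower_left by blast
  ultimately have "lambda18 * \<tau> = lambda18 * (2 * (z - w * c))" by (simp add: algebra_simps)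
  then have "\<tau> = 2 * (z - w * c)" using lambda18_bounds by simp
  then show False using \<tau>_not_even[of "z - w * c"] z w c by simp
qed

section \<open>Finite index and the invariant trace field\<close>

text \<open>The vector (b, x - a) satisfies the first row identically and the second by the
  characteristic equation; (x - d, c) works with the rows exchanged. If both vanish, A is x times
  the identity.\<close>

lemma eigenvector_exists:
  fixes A :: mat2
  assumes "A \<in> SL2" "trace A = x + inverse x" "x \<noteq> 0"
  shows "\<exists>v. v \<noteq> 0 \<and> A *v v = x *\<^sub>R v"
proof -
  obtain a b c d where A: "A = mk2 a b c d" by (rule mk2_cases)
  have D: "a * d - b * c = 1" and t: "a + d = x + inverse x"
    using assms by (simp_all add: A SL2_def)
  have "x * x - (a + d) * x + 1 = 0" unfolding t using assms(3) by (simp add: algebra_simps)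
  then have chi: "(x - a) * (x - d) = b * c" using D by (simp add: algebra_simps)
  have ex: ?thesis if "p \<noteq> 0 \<or> q \<noteq> 0" "a * p + b * q = x * p" "c * p + d * q = x * q" for p q
    using that by (intro exI[of _ "vector [p, q]"]) (auto simp: A vec_eq_iff forall_2 vector_2)
  show ?thesis
  proof (cases "b \<noteq> 0 \<or> x \<noteq> a")
    case True
    then show ?thesis using chi by (intro ex[of b "x - a"]) (auto simp: algebra_simps)
  next
    case False
    show ?thesis
    proof (cases "c \<noteq> 0 \<or> x \<noteq> d")
      case True
      then show ?thesis using chi by (intro ex[of "x - d" c]) (auto simp: algebra_simps)
    next
      case 2: False
      then show ?thesis using False by (intro ex[of 1 0]) auto
    qed
  qed
qed

section \<open>Inequivalence of the eigendirections under the Hecke group\<close>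

text \<open>For n at least 1 this spans the expanding eigenline. A vector chosen on a line is fixed
  only up to a scalar, so the statements about equivalence carry a factor c.\<close>

definition w18 :: "nat \<Rightarrow> real^2" where
  "w18 n = (SOME v. v \<noteq> 0 \<and> W18 n *v v = \<xi> ^ (2 * n) *\<^sub>R v)"

lemma w18: "w18 n \<noteq> 0" "W18 n *v w18 n = \<xi> ^ (2 * n) *\<^sub>R w18 n"
proof -
  have "\<exists>v. v \<noteq> 0 \<and> W18 n *v v = \<xi> ^ (2 * n) *\<^sub>R v"
    using eigenvector_exists[OF G18_SL2[OF W18_G18] trace_W18_\<xi>] \<xi>_gt_1 by simp
  from someI_ex[OF this] show "w18 n \<noteq> 0" "W18 n *v w18 n = \<xi> ^ (2 * n) *\<^sub>R w18 n"
    unfolding w18_def by blast+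
qed

lemma w18_inequivalent:
  assumes "i < j" "g \<in> G18" "g *v w18 (2 ^ j) = c *\<^sub>R w18 (2 ^ i)"
  shows False
proof -
  \<comment> \<open>One factor 2 is held back from 2^(j-i), so that the exponent relating the two
    eigenvalues has the form 2s.\<close>
  define s :: nat where "s = 2 ^ (j - Suc i)"
  let ?n = "2 ^ j :: nat" and ?m = "2 ^ i :: nat"
  have n: "?n = ?m * (2 * s)"
    using assms(1) by (simp add: s_def flip: power_add power_Suc)
  note g = G18_SL2[OF assms(2)]
  have inv_w: "matrix_inv g *v (g *v w18 ?n) = w18 ?n"
    by (simp add: matrix_vector_mul_assoc SL2_inv(1)[OF g])
  then have c: "c \<noteq> 0" using w18(1)[of ?n] by (auto simp: assms(3))
  define H where "H = g ** W18 ?n ** matrix_inv g"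
  have "H *v (g *v w18 ?n) = g *v (W18 ?n *v (matrix_inv g *v (g *v w18 ?n)))"
    by (simp add: H_def matrix_vector_mul_assoc matrix_mul_assoc)
  also have "\<dots> = \<xi> ^ (2 * ?n) *\<^sub>R (g *v w18 ?n)"
    unfolding inv_w w18(2) by (rule matrix_vector_mult_scaleR)
  finally have "H *v w18 ?m = \<xi> ^ (2 * ?n) *\<^sub>R w18 ?m"
    unfolding assms(3) matrix_vector_mult_scaleR using c
    by (metis scaleR_left_commute scaleR_cancel_left)
  moreover have "mpow (W18 ?m) (2 * s) *v w18 ?m = \<xi> ^ (2 * ?n) *\<^sub>R w18 ?m"
    unfolding mpow_eigen[OF w18(2)] n by (simp add: mult_ac flip: power_mult)
  moreover have "\<xi> ^ (2 * ?n) > 1" using \<xi>_gt_1 by (intro one_less_power) auto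
  moreover have "H \<in> G18" "mpow (W18 ?m) (2 * s) \<in> G18"
    unfolding H_def by (intro G18_mult G18_inv mpow_G18 W18_G18 assms(2))+
  ultimately have "H = mpow (W18 ?m) (2 * s)"
    using G18_hyperbolic_unique w18(1) by blast
  moreover have "matrix_inv g ** H ** g = (matrix_inv g ** g) ** W18 ?n ** (matrix_inv g ** g)"
    by (simp add: H_def matrix_mul_assoc)
  ultimately have "W18 ?n = matrix_inv g ** mpow (W18 ?m) (2 * s) ** g"
    by (simp add: SL2_inv(1)[OF g])
  then show False by (rule W18_not_conj_even_power[OF assms(2)])
qed

section \<open>Powers in finite-index subgroups and the field of the squared elements\<close>

text \<open>By the pigeonhole principle two of the cosets of H by powers of A coincide, and the
  quotient of these powers lies in H.\<close>

lemma finite_index_power: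
  assumes "is_subgroup_SL2 G" "is_subgroup_SL2 H" "finite_index H G" "A \<in> G"
  shows "\<exists>k\<ge>1. mpow A k \<in> H"
proof -
  define f where "f i = (\<lambda>x. mpow A i ** x) ` H" for i
  have "range f \<subseteq> {(\<lambda>x. g ** x) ` H | g. g \<in> G}"
    using mpow_subgroup[OF assms(1,4)] by (auto simp: f_def)
  then have "finite (range f)" using assms(3) unfolding finite_index_def by (rule finite_subset)
  then have "\<not> inj f" using finite_imageD infinite_UNIV_nat by blast
  then obtain i j where ij: "i < j" "f i = f j"
    unfolding inj_on_def by (metis linorder_neqE_nat)
  have A: "A \<in> SL2" and 1: "mat 1 \<in> H" using assms by (auto simp: is_subgroup_SL2_def)
  have "mpow A j \<in> f j" using 1 by (auto simp: f_def intro!: image_eqI[of _ _ "mat 1"])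
  then obtain h where h: "h \<in> H" "mpow A j = mpow A i ** h"
    unfolding ij(2)[symmetric] by (auto simp: f_def)
  moreover have "mpow A j = mpow A i ** mpow A (j - i)"
    using ij(1) by (simp flip: mpow_add)
  ultimately have "h = mpow A (j - i)" using SL2_left_cancel[OF mpow_SL2[OF A]] by metis
  then show ?thesis using h ij by (intro exI[of _ "j - i"]) auto
qed

lemma subfield_closed:
  assumes "is_subfield_R F"
  shows "0 \<in> F" "1 \<in> F" "x \<in> F \<Longrightarrow> y \<in> F \<Longrightarrow> x + y \<in> F" "x \<in> F \<Longrightarrow> y \<in> F \<Longrightarrow> x * y \<in> F"
    "x \<in> F \<Longrightarrow> y \<in> F \<Longrightarrow> x - y \<in> F" "x \<in> F \<Longrightarrow> y \<in> F \<Longrightarrow> x / y \<in> F"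
  using assms unfolding is_subfield_R_def diff_conv_add_uminus divide_inverse by blast+

lemma subfield_of_int:
  assumes "is_subfield_R F" shows "of_int n \<in> F"
proof (induction n rule: int_induct[of _ 0])
  case (step1 i)
  then show ?case using subfield_closed(2,3)[OF assms] by simp
next
  case (step2 i)
  then show ?case using subfield_closed(2,5)[OF assms] by simp
qed (simp add: subfield_closed[OF assms])

lemma Zt_subset_subfield:
  assumes "is_subfield_R F" "\<tau> \<in> F" shows "Zt \<subseteq> F"
proof
  fix x assume "x \<in> Zt"
  then obtain a b c where x: "x = of_int a + of_int b * \<tau> + of_int c * \<tau>\<^sup>2"
    unfolding Zt_def by blast
  note cl = subfield_closed(3,4)[OF assms(1)] subfield_of_int[OF assms(1)]
  show "x \<in> F" unfolding x power2_eq_square by (intro cl assms(2))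
qed

lemma invariant_trace_field_subfield: "is_subfield_R (invariant_trace_field V)"
  unfolding invariant_trace_field_def is_subfield_R_def by auto

lemma trace_square_in_invariant_trace_field:
  "A \<in> V \<Longrightarrow> trace (A ** A) \<in> invariant_trace_field V"
  unfolding invariant_trace_field_def by blast

text \<open>For \<open>A = T\<^sup>k\<^sup>N L\<^sup>M\<close> the trace of \<open>A\<^sup>2\<close> is \<open>2 + 4 k N M \<tau> + (k N M \<tau>)\<^sup>2\<close>; the quadratic
  term is eliminated between \<open>k = 1\<close> and \<open>k = 2\<close>.\<close>
lemma Zt_subset_invariant_trace_field:
  assumes g: "g \<in> SL2" and V: "is_subgroup_SL2 V"
    and T: "mpow T18 N \<in> (\<lambda>A. g ** A ** matrix_inv g) ` V"
    and L: "mpow L18 M \<in> (\<lambda>A. g ** A ** matrix_inv g) ` V"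
    and "N \<ge> 1" "M \<ge> 1"
  shows "Zt \<subseteq> invariant_trace_field V"
proof -
  let ?F = "invariant_trace_field V"
  note F = invariant_trace_field_subfield[of V]
  note cl = subfield_closed[OF F] subfield_of_int[OF F]
  obtain A where A: "A \<in> V" "mpow T18 N = g ** A ** matrix_inv g" using T by blast
  obtain B where B: "B \<in> V" "mpow L18 M = g ** B ** matrix_inv g" using L by blast
  define c where "c = real N * real M"
  have c: "c > 0" using assms by (simp add: c_def)
  have tr: "2 + 4 * (k * c * \<tau>) + (k * c * \<tau>)\<^sup>2 \<in> ?F" for k :: nat
  proof -
    define X where "X = mpow A k ** B"
    have X: "X \<in> V"
      using A B V mpow_subgroup[OF V, of A k] unfolding X_def is_subgroup_SL2_def by blast
    have "mpow (mpow T18 N) k ** mpow L18 M =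
        g ** mpow A k ** (matrix_inv g ** g) ** B ** matrix_inv g"
      unfolding A(2) B(2) mpow_conj[OF g] by (simp add: matrix_mul_assoc)
    then have "g ** X ** matrix_inv g = mpow (mpow T18 N) k ** mpow L18 M"
      by (simp add: X_def SL2_inv(1)[OF g] matrix_mul_assoc)
    also have "\<dots> = mk2 (1 + k * c * \<tau>) (k * N * lambda18) (M * lambda18) 1"
      by (simp add: T18_def L18_def mpow_unipotent c_def \<tau>_def power2_eq_square)
    finally have "trace (g ** X ** matrix_inv g) = 2 + k * c * \<tau>" by simp
    then have "trace X = 2 + k * c * \<tau>" unfolding trace_conj[OF g] .
    moreover have "X \<in> SL2" using X V by (auto simp: is_subgroup_SL2_def)
    ultimately have "trace (X ** X) = (2 + k * c * \<tau>) * (2 + k * c * \<tau>) - 2"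
      by (simp add: cayley_hamilton_SL2 trace_sub trace_scaleR_mat2 mat_1_mk2)
    then show ?thesis
      using trace_square_in_invariant_trace_field[OF X]
      by (simp add: power2_eq_square algebra_simps)
  qed
  define x y where "x = 2 + 4 * (c * \<tau>) + (c * \<tau>)\<^sup>2" and "y = 2 + 4 * (2 * c * \<tau>) + (2 * c * \<tau>)\<^sup>2"
  have eq: "(of_int 4 * x - y - of_int 6) / of_int (8 * int N * int M) = \<tau>"
    using assms(5,6) by (simp add: x_def y_def c_def power2_eq_square field_simps)
  have "x \<in> ?F" "y \<in> ?F" using tr[of 1] tr[of 2] by (simp_all add: x_def y_def)
  then have "(of_int 4 * x - y - of_int 6) / of_int (8 * int N * int M) \<in> ?F"
    by (intro cl)
  then have "\<tau> \<in> ?F" unfolding eq .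
  then show ?thesis by (rule Zt_subset_subfield[OF F])
qed

text \<open>Speciality asks for every eigenvalue to lie in the field. Applying Cayley-Hamilton to an
  eigenvector leaves x and its inverse as the only candidates.\<close>

lemma eigenvalue_SL2:
  assumes "A \<in> SL2" "trace A = x + inverse x" "x \<noteq> 0" "eigenvalue A c"
  shows "c = x \<or> c = inverse x"
proof -
  obtain v where v: "v \<noteq> 0" "A *v v = c *\<^sub>R v" using assms(4) unfolding eigenvalue_def by blast
  have "A *v (A *v v) = (A ** A) *v v" by (rule matrix_vector_mul_assoc)
  also have "\<dots> = trace A *\<^sub>R (A *v v) - v"
    unfolding cayley_hamilton_SL2[OF assms(1)]
    by (simp add: matrix_vector_mult_diff_rdistrib scaleR_matrix_vector_assoc)
  finally have "(c * c - trace A * c + 1) *\<^sub>R v = 0"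
    by (simp add: v matrix_vector_mult_scaleR algebra_simps)
  then have "c * c - (x + inverse x) * c + 1 = 0" using v(1) assms(2) by simp
  then have "(c - x) * (c - inverse x) = 0" using assms(3) by (simp add: algebra_simps)
  then show ?thesis by auto
qed

lemma special_hyperbolicI:
  assumes "A \<in> SL2" "trace A = x + inverse x" "x > 1"
    and "x \<in> invariant_trace_field V" "inverse x \<in> invariant_trace_field V"
  shows "special_hyperbolic V A"
proof -
  have "(x - 1)\<^sup>2 / x > 0" using assms(3) by simp
  also have "(x - 1)\<^sup>2 / x = x + inverse x - 2"
    using assms(3) by (simp add: power2_eq_square field_simps)
  finally have "hyperbolic A" by (simp add: hyperbolic_def assms(2))
  then show ?thesis
    using eigenvalue_SL2[OF assms(1,2)] assms(3-5) unfolding special_hyperbolic_def by auto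
qed

section \<open>Passage to the commensurable group\<close>

lemma is_subgroup_SL2_conj:
  assumes V: "is_subgroup_SL2 V" and g: "g \<in> SL2"
  shows "is_subgroup_SL2 ((\<lambda>A. g ** A ** matrix_inv g) ` V)" (is "is_subgroup_SL2 (?c ` V)")
  unfolding is_subgroup_SL2_def
proof (intro conjI ballI)
  have 1: "mat 1 \<in> V" and mult: "\<And>A B. A \<in> V \<Longrightarrow> B \<in> V \<Longrightarrow> A ** B \<in> V"
    and inv: "\<And>A. A \<in> V \<Longrightarrow> matrix_inv A \<in> V" and sub: "V \<subseteq> SL2"
    using V by (auto simp: is_subgroup_SL2_def)
  show "?c ` V \<subseteq> SL2" using sub g SL2_mult SL2_inv(3) by blast
  show "mat 1 \<in> ?c ` V" using 1 by (intro image_eqI[of _ _ "mat 1"]) (simp_all add: SL2_inv(2) g)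
  have conj_mult: "?c A ** ?c B = ?c (A ** B)" for A B
  proof -
    have "?c A ** ?c B = g ** A ** (matrix_inv g ** g) ** B ** matrix_inv g"
      by (simp add: matrix_mul_assoc)
    then show ?thesis by (simp add: SL2_inv(1) g matrix_mul_assoc)
  qed
  fix X assume "X \<in> ?c ` V"
  then obtain A where A: "A \<in> V" "X = ?c A" by blast
  show "X ** Y \<in> ?c ` V" if "Y \<in> ?c ` V" for Y
  proof -
    obtain B where "B \<in> V" "Y = ?c B" using \<open>Y \<in> ?c ` V\<close> by blast
    then show ?thesis unfolding A(2) using conj_mult mult[OF A(1)] by blast
  qed
  have "A \<in> SL2" using A(1) sub by blast
  then have "matrix_inv X = ?c (matrix_inv A)"
    unfolding A(2) by (intro matrix_inv_eqI) (simp_all add: conj_mult SL2_inv g)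
  then show "matrix_inv X \<in> ?c ` V" using inv[OF A(1)] by blast
qed

lemma image_span_singleton: "(\<lambda>x. (A :: mat2) *v x) ` span {v} = span {A *v v}"
  by (simp add: linear_span_image[of "(*v) A", symmetric] matrix_vector_mul_linear)

text \<open>Pulled back by the conjugating matrix, the lines of \<open>w18 (2 ^ i)\<close> become
  directions for \<open>V\<close>. If they met only finitely many \<open>V\<close>-orbits, two of
  them would be related by an element of the intersection with \<open>G18\<close>, since that
  intersection has finite index in the conjugate of \<open>V\<close>.\<close>

theorem theorem1p2:
  fixes V :: "mat2 set"
  assumes "is_subgroup_SL2 V"
    and "commensurable V G18"
  shows "infinite {dir_orbit V L | L. L \<in> directions \<and>
           (\<exists>A\<in>V. special_hyperbolic V A \<and> eigendirection A L)}"
proof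
  let ?\<O> = "{dir_orbit V L | L. L \<in> directions \<and>
           (\<exists>A\<in>V. special_hyperbolic V A \<and> eigendirection A L)}"
  assume fin: "finite ?\<O>"
  obtain g where g: "g \<in> SL2"
    and fi: "finite_index ((\<lambda>A. g ** A ** matrix_inv g) ` V \<inter> G18) ((\<lambda>A. g ** A ** matrix_inv g) ` V)"
      "finite_index ((\<lambda>A. g ** A ** matrix_inv g) ` V \<inter> G18) G18"
    using assms(2) unfolding commensurable_def Let_def by blast
  let ?g' = "matrix_inv g"
  define V' where "V' = (\<lambda>A. g ** A ** ?g') ` V"
  define H where "H = V' \<inter> G18"
  note fi = fi[folded V'_def, folded H_def]
  have V_SL2: "A \<in> SL2" if "A \<in> V" for A using that assms(1) by (auto simp: is_subgroup_SL2_def)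
  have V': "is_subgroup_SL2 V'"
    unfolding V'_def by (rule is_subgroup_SL2_conj[OF assms(1) g])
  have H: "is_subgroup_SL2 H"
    using V' is_subgroup_G18 unfolding H_def is_subgroup_SL2_def by blast
  have power: "\<exists>k\<ge>1. mpow A k \<in> V'" if "A \<in> G18" for A
    using finite_index_power[OF is_subgroup_G18 H fi(2) that] unfolding H_def by blast
  obtain N M where "N \<ge> 1" "mpow T18 N \<in> V'" "M \<ge> 1" "mpow L18 M \<in> V'"
    using power[OF T18_G18] power[OF L18_G18] by blast
  then have Zt: "Zt \<subseteq> invariant_trace_field V"
    using Zt_subset_invariant_trace_field[OF g assms(1)] unfolding V'_def by blast
  define w where "w i = w18 (2 ^ i)" for i :: nat
  define D where "D i = span {?g' *v w i}" for i
  have gw: "g *v (?g' *v u) = u" for u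
    by (simp add: matrix_vector_mul_assoc SL2_inv(2)[OF g])
  have nz: "?g' *v w i \<noteq> 0" for i
    using gw[of "w i"] w18(1) by (auto simp: w_def)
  have orbit: "dir_orbit V (D i) \<in> ?\<O>" for i
  proof -
    let ?n = "2 ^ i :: nat"
    \<comment> \<open>Passing to a power keeps the eigenvector and replaces the eigenvalue by a
      further power of \<open>\<xi>\<close>. It and its inverse stay in \<open>Zt\<close>, hence in
      the invariant trace field.\<close>
    obtain k where k: "k \<ge> 1" "mpow (W18 ?n) k \<in> V'" using power[OF W18_G18] by blast
    then obtain A where A: "A \<in> V" "mpow (W18 ?n) k = g ** A ** ?g'"
      unfolding V'_def by blast
    define x where "x = \<xi> ^ (2 * ?n * k)"
    have x: "x > 1" unfolding x_def using \<xi>_gt_1 k by (intro one_less_power) auto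
    have "trace A = trace (mpow (W18 ?n) k)" unfolding A(2) trace_conj[OF g] ..
    also have "\<dots> = x + inverse x"
      using trace_mpow_eigen[OF G18_SL2[OF W18_G18] trace_W18_\<xi>] \<xi>_gt_1
      by (simp add: x_def power_mult power_inverse)
    finally have tr: "trace A = x + inverse x" .
    have "x \<in> Zt" "inverse x \<in> Zt"
      using Zt_power[OF \<xi>_Zt] Zt_power[OF inverse_\<xi>_Zt] by (simp_all add: x_def power_inverse)
    then have special: "special_hyperbolic V A"
      using Zt by (intro special_hyperbolicI[OF V_SL2[OF A(1)] tr x]) auto
    have "A *v (?g' *v w i) = ?g' *v ((g ** A ** ?g') *v w i)"
      by (simp add: matrix_vector_mul_assoc matrix_mul_assoc SL2_inv(1)[OF g])
    also have "\<dots> = x *\<^sub>R (?g' *v w i)"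
      unfolding A(2)[symmetric] w_def mpow_eigen[OF w18(2)]
      by (simp add: matrix_vector_mult_scaleR x_def power_mult)
    finally have "eigendirection A (D i)"
      using nz unfolding eigendirection_def D_def by blast
    moreover have "D i \<in> directions" using nz unfolding directions_def D_def by blast
    ultimately show ?thesis using special A(1) by blast
  qed
  have "finite (range (\<lambda>i. dir_orbit V (D i)))"
    using orbit by (intro finite_subset[OF _ fin]) blast
  then obtain i0 where inf: "infinite {i. dir_orbit V (D i) = dir_orbit V (D i0)}"
    using pigeonhole_infinite[of UNIV "\<lambda>i. dir_orbit V (D i)"] by auto
  let ?I = "{i. dir_orbit V (D i) = dir_orbit V (D i0)}"
  have "\<exists>h\<in>V'. \<exists>c. c \<noteq> 0 \<and> w i = c *\<^sub>R (h *v w i0)" if i: "i \<in> ?I" for i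
  proof -
    have "mat 1 \<in> V" using assms(1) by (simp add: is_subgroup_SL2_def)
    then have "(\<lambda>x. mat 1 *v x) ` D i \<in> dir_orbit V (D i)"
      unfolding dir_orbit_def by blast
    then have "D i \<in> dir_orbit V (D i0)" using i by simp
    then obtain A where A: "A \<in> V" "D i = (\<lambda>x. A *v x) ` D i0"
      unfolding dir_orbit_def by blast
    then have "?g' *v w i \<in> span {A *v (?g' *v w i0)}"
      unfolding D_def image_span_singleton using span_base by blast
    then obtain c where c: "?g' *v w i = c *\<^sub>R (A *v (?g' *v w i0))"
      unfolding span_singleton by blast
    have "w i = c *\<^sub>R ((g ** A ** ?g') *v w i0)"
      using arg_cong[OF c, of "(*v) g"] unfolding gw
      by (simp add: matrix_vector_mult_scaleR matrix_vector_mul_assoc matrix_mul_assoc)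
    moreover from this have "c \<noteq> 0" using w18(1) by (auto simp: w_def)
    ultimately show ?thesis using A(1) unfolding V'_def by blast
  qed
  then obtain h c where h: "\<And>i. i \<in> ?I \<Longrightarrow> h i \<in> V'" "\<And>i. i \<in> ?I \<Longrightarrow> c i \<noteq> 0"
    "\<And>i. i \<in> ?I \<Longrightarrow> w i = c i *\<^sub>R (h i *v w i0)"
    by metis
  have h_SL2: "h i \<in> SL2" if "i \<in> ?I" for i
    using h(1)[OF that] V' by (auto simp: is_subgroup_SL2_def)
  \<comment> \<open>The inverses are needed because the left cosets of the inverses of
    \<open>h i\<close> and \<open>h j\<close> agree exactly when
    \<open>h i ** matrix_inv (h j)\<close> lies in \<open>H\<close>. This quotient carries the line
    of \<open>w j\<close> to that of \<open>w i\<close>, since both come from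
    \<open>w i0\<close>.\<close>
  define coset where "coset i = (\<lambda>x. matrix_inv (h i) ** x) ` H" for i
  have "coset ` ?I \<subseteq> {(\<lambda>x. v ** x) ` H | v. v \<in> V'}"
    using h(1) V' unfolding coset_def is_subgroup_SL2_def by blast
  then have "finite (coset ` ?I)" using fi(1) unfolding finite_index_def by (rule finite_subset)
  then have "\<not> inj_on coset ?I" using finite_imageD inf by blast
  then obtain i j where ij: "i \<in> ?I" "j \<in> ?I" "i < j" "coset i = coset j"
    unfolding inj_on_def by (metis linorder_neqE_nat)
  have "mat 1 \<in> H" using H by (simp add: is_subgroup_SL2_def)
  then have "matrix_inv (h j) ** mat 1 \<in> coset j"
    unfolding coset_def by (rule imageI)
  then have "matrix_inv (h j) \<in> coset i" using ij(4) by simp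
  then obtain x where x: "x \<in> H" "matrix_inv (h j) = matrix_inv (h i) ** x"
    unfolding coset_def by (elim imageE)
  have "x = h i ** matrix_inv (h j)"
    by (simp add: x(2) matrix_mul_assoc SL2_inv(2)[OF h_SL2[OF ij(1)]])
  then have "x ** h j = h i"
    by (simp add: SL2_inv(1)[OF h_SL2[OF ij(2)]] flip: matrix_mul_assoc)
  then have "x *v w j = c j *\<^sub>R (h i *v w i0)"
    unfolding h(3)[OF ij(2)] matrix_vector_mult_scaleR by (simp add: matrix_vector_mul_assoc)
  also have "\<dots> = (c j / c i) *\<^sub>R w i"
    unfolding h(3)[OF ij(1)] using h(2)[OF ij(1)] by simp
  finally show False
    using w18_inequivalent[OF ij(3)] x(1) unfolding H_def w_def by blast
qed

end
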